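(* Assume $\int_{\mathrm{supp}(h)}|g(s)|\,|h(s)|^{-(c+1)/2}ds<\infty$. Then the operator $\tilde{\mathcal{G}}:=\mathcal{F}_\times\mathcal{M}\mathcal{G}\mathcal{M}^{-1}\mathcal{F}_\times^{-1}$ on $L^2(\mathbb{R}^\times,\frac{dx}{|x|})$ satisfies $\tilde{\mathcal{G}}\varphi=\mu\varphi$ for all $\varphi\in L^2(\mathbb{R}^\times,\frac{dx}{|x|})$, where $\mu$ is the bounded continuous function defined below.
   Context: $\mathbb{R}^\times=\mathbb{R}\setminus\{0\}$. Fix $c\in\mathbb{R}$, $d\ge1$, measurable $g,h:\mathbb{R}^d\to\mathbb{R}$, $\mathrm{supp}(h)=\{h\ne0\}$. $\mathcal{G}$ is the bounded operator on $L^2(\mathbb{R}^\times,|x|^cdx)$ given by $(\mathcal{G}w)(x)=\int_{\mathrm{supp}(h)}g(s)w(h(s)x)ds$. Define $m_+(x)=\int_{\mathrm{supp}(h)}g(s)|h(s)|^{-(c+1)/2}e^{ix\log|h(s)|}ds$, $m_-(x)=\int_{\mathrm{supp}(h)}g(s)|h(s)|^{-(c+1)/2}e^{ix\log|h(s)|}\mathrm{sgn}h(s)\,ds$ ($x\in\mathbb{R}$), and $\mu(y)=m_+(\log|y|)$ for $y>0$, $\mu(y)=m_-(\log|y|)$ for $y<0$. $\delta(x)=0$ for $x>0$ and $1$ for $x<0$. $\mathcal{F}_\times$ is the bounded bijective operator on $L^2(\mathbb{R}^\times,\frac{dx}{|x|})$ given on $L^1\cap L^2$ by $(\mathcal{F}_\times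 u)(y)=\int_{\mathbb{R}^\times}u(x)e^{-i\log|x|\log|y|}e^{i\pi\delta(x)\delta(y)}\frac{dx}{|x|}$ and extended by continuity ($\frac1{2\sqrt\pi}\mathcal{F}_\times$ unitary). $\mathcal{M}:L^2(\mathbb{R}^\times,|x|^cdx)\to L^2(\mathbb{R}^\times,\frac{dx}{|x|})$, $(\mathcal{M}u)(x)=|x|^{(c+1)/2}u(x)$, is unitary. *)

theory Defs
  imports "HOL-Analysis.Analysis"
begin

text \<open>Complex-valued functions on the reals; the point 0 is a null set, so functions
on R-times are represented as functions on R whose value at 0 is irrelevant.
Weights: w_c x = |x| powr c (measure |x|^c dx), w_inv x = 1/|x| (measure dx/|x|).\<close>

definition wc :: "real \<Rightarrow> real \<Rightarrow> real" where
  "wc c x = \<bar>x\<bar> powr c"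

definition winv :: "real \<Rightarrow> real" where
  "winv x = 1 / \<bar>x\<bar>"

definition memL2 :: "(real \<Rightarrow> real) \<Rightarrow> (real \<Rightarrow> complex) \<Rightarrow> bool" where
  "memL2 w u \<longleftrightarrow> u \<in> borel_measurable lborel \<and>
     (\<integral>\<^sup>+ x. ennreal (w x * (cmod (u x))\<^sup>2) \<partial>lborel) < \<infinity>"

definition memL1 :: "(real \<Rightarrow> real) \<Rightarrow> (real \<Rightarrow> complex) \<Rightarrow> bool" where
  "memL1 w u \<longleftrightarrow> u \<in> borel_measurable lborel \<and>
     (\<integral>\<^sup>+ x. ennreal (w x * cmod (u x)) \<partial>lborel) < \<infinity>"

definition L2conv :: "(real \<Rightarrow> real) \<Rightarrow> (nat \<Rightarrow> real \<Rightarrow> complex) \<Rightarrow> (real \<Rightarrow> complex) \<Rightarrow> bool" where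
  "L2conv w U u \<longleftrightarrow>
     (\<lambda>n. \<integral>\<^sup>+ x. ennreal (w x * (cmod (U n x - u x))\<^sup>2) \<partial>lborel) \<longlonglongrightarrow> 0"

definition delta :: "real \<Rightarrow> real" where
  "delta x = (if x < 0 then 1 else 0)"

definition Fx_int :: "(real \<Rightarrow> complex) \<Rightarrow> real \<Rightarrow> complex" where
  "Fx_int u y = (\<integral> x. u x * cis (- (ln \<bar>x\<bar> * ln \<bar>y\<bar>)) * cis (pi * delta x * delta y)
                   / complex_of_real \<bar>x\<bar> \<partial>lborel)"

text \<open>Its extension by continuity to L 2(dx/|x|): the L 2-limit of the transforms of
any L^1 \<inter> L^2 approximating sequence (a representative is chosen).\<close>
definition Fx_rel :: "(real \<Rightarrow> complex) \<Rightarrow> (real \<Rightarrow> complex) \<Rightarrow> bool" where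
  "Fx_rel u v \<longleftrightarrow> memL2 winv u \<and> memL2 winv v \<and>
     (\<exists>U. (\<forall>n. memL1 winv (U n) \<and> memL2 winv (U n)) \<and> L2conv winv U u \<and>
          L2conv winv (\<lambda>n. Fx_int (U n)) v)"

definition Fx :: "(real \<Rightarrow> complex) \<Rightarrow> real \<Rightarrow> complex" where
  "Fx u = (SOME v. Fx_rel u v)"

definition Fx_inv :: "(real \<Rightarrow> complex) \<Rightarrow> real \<Rightarrow> complex" where
  "Fx_inv v = (SOME u. Fx_rel u v)"

text \<open>The unitary M : L 2(|x| c dx) \<rightarrow> L 2(dx/|x|) and its inverse.\<close>
definition Mop :: "real \<Rightarrow> (real \<Rightarrow> complex) \<Rightarrow> real \<Rightarrow> complex" where
  "Mop c u x = complex_of_real (\<bar>x\<bar> powr ((c + 1) / 2)) * u x"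

definition Mop_inv :: "real \<Rightarrow> (real \<Rightarrow> complex) \<Rightarrow> real \<Rightarrow> complex" where
  "Mop_inv c u x = complex_of_real (\<bar>x\<bar> powr (- (c + 1) / 2)) * u x"

definition Gop :: "(real^'n \<Rightarrow> real) \<Rightarrow> (real^'n \<Rightarrow> real) \<Rightarrow> (real \<Rightarrow> complex) \<Rightarrow> real \<Rightarrow> complex" where
  "Gop g h w x = (\<integral> s. indicator {s. h s \<noteq> 0} s * complex_of_real (g s) * w (h s * x) \<partial>lebesgue)"

definition m_plus :: "real \<Rightarrow> (real^'n \<Rightarrow> real) \<Rightarrow> (real^'n \<Rightarrow> real) \<Rightarrow> real \<Rightarrow> complex" where
  "m_plus c g h x = (\<integral> s. indicator {s. h s \<noteq> 0} s *
      complex_of_real (g s * \<bar>h s\<bar> powr (- (c + 1) / 2)) * cis (x * ln \<bar>h s\<bar>) \<partial>lebesgue)"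

definition m_minus :: "real \<Rightarrow> (real^'n \<Rightarrow> real) \<Rightarrow> (real^'n \<Rightarrow> real) \<Rightarrow> real \<Rightarrow> complex" where
  "m_minus c g h x = (\<integral> s. indicator {s. h s \<noteq> 0} s *
      complex_of_real (g s * \<bar>h s\<bar> powr (- (c + 1) / 2)) * cis (x * ln \<bar>h s\<bar>)
      * complex_of_real (sgn (h s)) \<partial>lebesgue)"

definition mu :: "real \<Rightarrow> (real^'n \<Rightarrow> real) \<Rightarrow> (real^'n \<Rightarrow> real) \<Rightarrow> real \<Rightarrow> complex" where
  "mu c g h y = (if y > 0 then m_plus c g h (ln \<bar>y\<bar>) else m_minus c g h (ln \<bar>y\<bar>))"

definition Gtilde :: "real \<Rightarrow> (real^'n \<Rightarrow> real) \<Rightarrow> (real^'n \<Rightarrow> real) \<Rightarrow> (real \<Rightarrow> complex) \<Rightarrow> real \<Rightarrow> complex" where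
  "Gtilde c g h \<phi> = Fx (Mop c (Gop g h (Mop_inv c (Fx_inv \<phi>))))"

end

theory Submission
  imports Defs "HOL-Probability.Characteristic_Functions"
begin

text \<open>
  The transform is the Fourier transform of the multiplicative group of nonzero reals, with
  characters \<open>chi x y\<close>. After conjugation by \<open>Mop c\<close> the operator becomes
  \<open>u \<mapsto> (\<lambda>x. \<integral> k(s) u(h(s) x) ds)\<close> with \<open>k = g \<bar>h\<bar> powr (-(c+1)/2)\<close> integrable, an average of
  dilations. It is bounded on \<open>L1\<close> and \<open>L2\<close> with norm at most \<open>\<integral> \<bar>k\<bar>\<close>, and since a dilation becomes
  multiplication by a character, Fubini gives the theorem on \<open>L1 \<inter> L2\<close>; it passes to \<open>L2\<close> by continuity.

  Since \<open>Fx\<close> and \<open>Fx_inv\<close> are choices of a limit, one needs in addition that \<open>Fx_rel\<close> is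
  single valued and onto. Both come from damping with a Gaussian \<open>gaussw n\<close> in \<open>ln \<bar>y\<bar>\<close>: the
  adjoint transform of \<open>gaussw n * Fx_int f\<close> is the convolution of \<open>f\<close> with \<open>gaussk n\<close>, a positive
  kernel of total mass \<open>4 * pi\<close> concentrating at 1. Its boundedness on \<open>L2\<close> yields
  \<open>nrm2 (Fx_int f) \<le> 4 * pi * nrm2 f\<close>, and its being an approximate identity yields the inversion formula
  on a dense set, from which surjectivity follows by completeness of \<open>L2\<close>.
\<close>

section \<open>The measure \<open>dx / \<bar>x\<bar>\<close>\<close>

text \<open>Why damping: for integrable \<open>f\<close> the function \<open>Fx_int f\<close> is
  only known to be bounded, so its adjoint transform need not converge absolutely. Multiplied by
  \<open>gaussw n\<close> it does, Fubini applies, and the factor is removed afterwards by Fatou or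
  by dominated convergence. Origin of \<open>4 * pi\<close>: the group is R times Z/2. Plancherel
  for the unnormalised kernel contributes 2 * pi on R and 2 on Z/2, which is the inverse square of
  the factor 1 / (2 sqrt pi) that makes the transform unitary. \<open>Fx_rel\<close> is treated as a
  graph, the L2 closure of the graph of \<open>Fx_int\<close>. The multiplier identity is a
  statement about pairs in this graph, so it applies to whichever preimage \<open>Fx_inv\<close>
  selects, and limits are taken in both coordinates at once. A divergent Bochner integral is 0 by
  convention, so averages of dilations are additive only where they converge absolutely; the
  \<open>ennreal\<close> majorant \<open>aconv\<close> controls where that happens.\<close>

definition nu :: "real measure" where
  "nu = density lborel (\<lambda>x. ennreal (winv x))"

lemma winv_measurable [measurable]: "winv \<in> borel_measurable borel"
  unfolding winv_def by measurable

lemma winv_nonneg [simp]: "winv x \<ge> 0"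
  by (simp add: winv_def)

lemma sets_nu [simp, measurable_cong]: "sets nu = sets borel"
  by (simp add: nu_def)

lemma space_nu [simp]: "space nu = UNIV"
  by (simp add: nu_def)

lemma nn_integral_nu:
  "f \<in> borel_measurable borel \<Longrightarrow> (\<integral>\<^sup>+x. f x \<partial>nu) = (\<integral>\<^sup>+x. ennreal (winv x) * f x \<partial>lborel)"
  unfolding nu_def by (subst nn_integral_density) auto

text \<open>The density at the excluded point is 1 / 0 = 0.\<close>

lemma AE_nu_nonzero: "AE x in nu. x \<noteq> 0"
  unfolding nu_def by (subst AE_density) (auto simp: winv_def)

text \<open>The density is positive off 0 and the point 0 is Lebesgue null. This returns the final
  identity from \<open>nu\<close> to \<open>lborel\<close>.\<close>

lemma AE_lborel_if_AE_nu:
  assumes "AE x in nu. P x"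
  shows "AE x in lborel. P x"
proof -
  have "AE x in lborel. ennreal (winv x) > 0 \<longrightarrow> P x"
    using assms unfolding nu_def by (subst (asm) AE_density) auto
  moreover have "AE x in lborel. x \<noteq> (0::real)"
    by (rule AE_lborel_singleton)
  ultimately show ?thesis
    by eventually_elim (auto simp: winv_def)
qed

lemma sigma_finite_nu: "sigma_finite_measure nu"
  unfolding nu_def
  by (subst sigma_finite_measure.sigma_finite_iff_density_finite)
     (auto intro: lborel.sigma_finite_measure_axioms)

interpretation nu: sigma_finite_measure nu
  by (rule sigma_finite_nu)

text \<open>This is the invariance of Haar measure on the multiplicative group, negative
  \<open>a\<close> included: the Jacobian |a| of the affine substitution cancels against
  \<open>winv (a * x) = winv x / |a|\<close>.\<close>

lemma distr_nu_mult:
  assumes "a \<noteq> 0"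
  shows "distr nu borel (\<lambda>x. a * x) = nu"
proof (rule measure_eqI)
  fix A :: "real set" assume "A \<in> sets (distr nu borel ((*) a))"
  then have [measurable]: "A \<in> sets borel" by simp
  have "emeasure (distr nu borel ((*) a)) A = (\<integral>\<^sup>+x. indicator A (a * x) \<partial>nu)"
    by (subst nn_integral_indicator[symmetric], simp, subst nn_integral_distr) auto
  also have "\<dots> = (\<integral>\<^sup>+x. ennreal (winv x) * indicator A (a * x) \<partial>lborel)"
    by (rule nn_integral_nu) measurable
  also have "\<dots> = (\<integral>\<^sup>+x. ennreal \<bar>a\<bar> * (ennreal (winv (a * x)) * indicator A (a * x)) \<partial>lborel)"
    using assms by (intro nn_integral_cong)
      (auto simp: winv_def abs_mult ennreal_mult'[symmetric] mult.assoc[symmetric] simp del: ennreal_1)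
  also have "\<dots> = (\<integral>\<^sup>+x. ennreal (winv x) * indicator A x \<partial>lborel)"
    using nn_integral_real_affine[of "\<lambda>x. ennreal (winv x) * indicator A x" a 0] assms
    by (simp add: nn_integral_cmult)
  also have "\<dots> = (\<integral>\<^sup>+x. indicator A x \<partial>nu)"
    by (rule nn_integral_nu[symmetric]) measurable
  finally show "emeasure (distr nu borel ((*) a)) A = emeasure nu A"
    by simp
qed simp

lemma nn_integral_nu_mult:
  assumes "a \<noteq> 0" and [measurable]: "f \<in> borel_measurable borel"
  shows "(\<integral>\<^sup>+x. f (a * x) \<partial>nu) = (\<integral>\<^sup>+x. f x \<partial>nu)"
  by (subst (2) distr_nu_mult[OF assms(1), symmetric], subst nn_integral_distr) auto

lemma integral_nu_mult:
  fixes f :: "real \<Rightarrow> 'b::{banach, second_countable_topology}"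
  assumes "a \<noteq> 0" and [measurable]: "f \<in> borel_measurable borel"
  shows "(\<integral>x. f (a * x) \<partial>nu) = (\<integral>x. f x \<partial>nu)"
  by (subst (2) distr_nu_mult[OF assms(1), symmetric], subst integral_distr) auto

text \<open>The substitution x = exp t turns dx / x into dt. It is carried out on the compact
  intervals \<open>J n\<close> and their images \<open>I n\<close>; monotone convergence then
  removes the cut-off.\<close>

lemma nn_integral_nu_pos:
  assumes [measurable]: "f \<in> borel_measurable borel"
  shows "(\<integral>\<^sup>+x. f x * indicator {0<..} x \<partial>nu) = (\<integral>\<^sup>+t. f (exp t) \<partial>lborel)"
proof -
  define I where "I n = {exp (- real (Suc n))..exp (real (Suc n))}" for n
  define J where "J n = {- real (Suc n)..real (Suc n)}" for n
  have [measurable]: "I n \<in> sets borel" "J n \<in> sets borel" for n by (simp_all add: I_def J_def)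
  have I_sup: "(SUP n. (indicator (I n) x :: ennreal)) = indicator {0<..} x" for x
  proof (cases "x > 0")
    case True
    obtain n where n: "real n \<ge> \<bar>ln x\<bar>" using real_arch_simple by blast
    have "exp (- real (Suc n)) \<le> exp (ln x)" "exp (ln x) \<le> exp (real (Suc n))"
      using n by (simp_all only: exp_le_cancel_iff)
    hence "x \<in> I n" using True by (simp add: I_def)
    hence "(1::ennreal) \<le> (SUP n. indicator (I n) x)" by (intro SUP_upper2[of n]) auto
    moreover have "(SUP n. (indicator (I n) x :: ennreal)) \<le> 1" by (intro SUP_least) (auto simp: indicator_def)
    ultimately have "(SUP n. (indicator (I n) x :: ennreal)) = 1" by (intro antisym)
    thus ?thesis using True by simp
  next
    case False
    have "x \<notin> I n" for n using False less_le_trans[OF exp_gt_zero, of "- real (Suc n)" x]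
      by (auto simp: I_def)
    with False show ?thesis by simp
  qed
  have J_sup: "(SUP n. (indicator (J n) x :: ennreal)) = 1" for x
  proof -
    obtain n where n: "real n \<ge> \<bar>x\<bar>" using real_arch_simple by blast
    hence "x \<in> J n" by (auto simp: J_def)
    hence "(1::ennreal) \<le> (SUP n. indicator (J n) x)" by (intro SUP_upper2[of n]) auto
    moreover have "(SUP n. (indicator (J n) x :: ennreal)) \<le> 1" by (intro SUP_least) (auto simp: indicator_def)
    ultimately show ?thesis by (intro antisym)
  qed
  have I_inc: "incseq (\<lambda>n. (indicator (I n) x :: ennreal))" for x
  proof (rule incseq_SucI)
    fix n
    have "exp (- real (Suc (Suc n))) \<le> exp (- real (Suc n))" "exp (real (Suc n)) \<le> exp (real (Suc (Suc n)))"
      by simp_all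
    thus "(indicator (I n) x :: ennreal) \<le> indicator (I (Suc n)) x"
      by (auto simp: I_def indicator_def simp del: exp_le_cancel_iff of_nat_Suc)
  qed
  have J_inc: "incseq (\<lambda>n. (indicator (J n) x :: ennreal))" for x
    by (rule incseq_SucI) (auto simp: J_def indicator_def)
  have step: "(\<integral>\<^sup>+x. (ennreal (winv x) * f x) * indicator (I n) x \<partial>lborel)
        = (\<integral>\<^sup>+t. f (exp t) * indicator (J n) t \<partial>lborel)" for n
  proof -
    have "(\<integral>\<^sup>+x. (ennreal (winv x) * f x) * indicator (I n) x \<partial>lborel)
        = (\<integral>\<^sup>+t. (ennreal (winv (exp t)) * f (exp t)) * ennreal (exp t) * indicator (J n) t \<partial>lborel)"
      unfolding I_def J_def
      by (rule nn_integral_substitution_aux) (auto intro!: derivative_eq_intros continuous_intros)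
    also have "\<dots> = (\<integral>\<^sup>+t. f (exp t) * indicator (J n) t \<partial>lborel)"
    proof (rule nn_integral_cong)
      fix t :: real
      have "ennreal (winv (exp t)) * ennreal (exp t) = 1"
        by (simp add: winv_def ennreal_mult'[symmetric])
      thus "ennreal (winv (exp t)) * f (exp t) * ennreal (exp t) * indicator (J n) t =
         f (exp t) * indicator (J n) t" by (metis mult.assoc mult.commute mult.right_neutral)
    qed
    finally show ?thesis .
  qed
  have "(\<integral>\<^sup>+x. f x * indicator {0<..} x \<partial>nu) = (\<integral>\<^sup>+x. (SUP n. (ennreal (winv x) * f x) * indicator (I n) x) \<partial>lborel)"
    by (subst nn_integral_nu, measurable) (simp add: SUP_mult_left_ennreal[symmetric] I_sup mult.assoc)
  also have "\<dots> = (SUP n. \<integral>\<^sup>+x. (ennreal (winv x) * f x) * indicator (I n) x \<partial>lborel)"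
    using I_inc by (intro nn_integral_monotone_convergence_SUP) (auto simp: incseq_def le_fun_def intro!: mult_left_mono)
  also have "\<dots> = (SUP n. \<integral>\<^sup>+t. f (exp t) * indicator (J n) t \<partial>lborel)"
    by (simp only: step)
  also have "\<dots> = (\<integral>\<^sup>+t. (SUP n. f (exp t) * indicator (J n) t) \<partial>lborel)"
    using J_inc by (intro nn_integral_monotone_convergence_SUP[symmetric]) (auto simp: incseq_def le_fun_def intro!: mult_left_mono)
  finally show ?thesis by (simp add: SUP_mult_left_ennreal[symmetric] J_sup)
qed

text \<open>Phrased as an equality of measures, the substitution x = exp t carries over to Bochner
  integrals of vector-valued functions.\<close>

lemma density_nu_pos: "density nu (indicator {0<..}) = distr lborel borel exp"
proof (rule measure_eqI)
  fix A assume "A \<in> sets (density nu (indicator {0<..}))"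
  hence [measurable]: "A \<in> sets borel" by simp
  have "emeasure (density nu (indicator {0<..})) A = (\<integral>\<^sup>+x. indicator A x * indicator {0<..} x \<partial>nu)"
    by (subst emeasure_density) (auto simp: mult.commute)
  also have "\<dots> = (\<integral>\<^sup>+t. indicator A (exp t) \<partial>lborel)"
    by (rule nn_integral_nu_pos) measurable
  also have "\<dots> = emeasure (distr lborel borel exp) A"
    by (subst nn_integral_indicator[symmetric], simp, subst nn_integral_distr) auto
  finally show "emeasure (density nu (indicator {0<..})) A = emeasure (distr lborel borel exp) A" .
qed simp

lemma integral_nu_split:
  fixes f :: "real \<Rightarrow> 'b::{banach, second_countable_topology}"
  assumes f: "integrable nu f"
  shows "(\<integral>x. f x \<partial>nu) = (\<integral>t. f (exp t) \<partial>lborel) + (\<integral>t. f (- exp t) \<partial>lborel)"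
proof -
  have [measurable]: "f \<in> borel_measurable borel"
    using f by (auto dest: borel_measurable_integrable)
  have pos: "(\<integral>x. indicator {0<..} x *\<^sub>R g x \<partial>nu) = (\<integral>t. g (exp t) \<partial>lborel)"
    if [measurable]: "g \<in> borel_measurable borel" for g :: "real \<Rightarrow> 'b"
  proof -
    have "(\<integral>x. indicator {0<..} x *\<^sub>R g x \<partial>nu) = (\<integral>x. g x \<partial>density nu (\<lambda>x. ennreal (indicator {0<..} x)))"
      by (subst integral_density) auto
    also have "\<dots> = (\<integral>t. g (exp t) \<partial>lborel)"
      by (simp add: ennreal_indicator density_nu_pos integral_distr)
    finally show ?thesis .
  qed
  have i: "integrable nu (\<lambda>x. indicator {0<..} x *\<^sub>R f x)" "integrable nu (\<lambda>x. indicator {..<0} x *\<^sub>R f x)"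
    by (rule integrable_mult_indicator[OF _ f], simp)+
  have "(\<integral>x. f x \<partial>nu) = (\<integral>x. indicator {0<..} x *\<^sub>R f x + indicator {..<0} x *\<^sub>R f x \<partial>nu)"
    using AE_nu_nonzero by (intro integral_cong_AE, measurable) (auto simp: indicator_def)
  also have "\<dots> = (\<integral>x. indicator {0<..} x *\<^sub>R f x \<partial>nu) + (\<integral>x. indicator {..<0} x *\<^sub>R f x \<partial>nu)"
    using i by (rule Bochner_Integration.integral_add)
  also have "(\<integral>x. indicator {..<0} x *\<^sub>R f x \<partial>nu) = (\<integral>x. indicator {..<0} (-1 * x) *\<^sub>R f (-1 * x) \<partial>nu)"
    by (rule integral_nu_mult[symmetric]) auto
  also have "\<dots> = (\<integral>x. indicator {0<..} x *\<^sub>R f (- x) \<partial>nu)"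
    by (intro Bochner_Integration.integral_cong) (auto simp: indicator_def)
  finally show ?thesis using pos[of f] pos[of "\<lambda>x. f (- x)"] by simp
qed

section \<open>Characters and Gaussians\<close>

lemma nn_integral_nu_split:
  assumes [measurable]: "f \<in> borel_measurable borel"
  shows "(\<integral>\<^sup>+x. f x \<partial>nu) = (\<integral>\<^sup>+t. f (exp t) \<partial>lborel) + (\<integral>\<^sup>+t. f (- exp t) \<partial>lborel)"
proof -
  have "(\<integral>\<^sup>+x. f x \<partial>nu) = (\<integral>\<^sup>+x. f x * indicator {0<..} x + f x * indicator {..<0} x \<partial>nu)"
    using AE_nu_nonzero by (intro nn_integral_cong_AE) (auto simp: indicator_def)
  also have "\<dots> = (\<integral>\<^sup>+x. f x * indicator {0<..} x \<partial>nu) + (\<integral>\<^sup>+x. f x * indicator {..<0} x \<partial>nu)"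
    by (rule nn_integral_add) auto
  also have "(\<integral>\<^sup>+x. f x * indicator {..<0} x \<partial>nu) = (\<integral>\<^sup>+x. f (-1 * x) * indicator {..<0} (-1 * x) \<partial>nu)"
    by (rule nn_integral_nu_mult[symmetric]) auto
  also have "\<dots> = (\<integral>\<^sup>+x. f (- x) * indicator {0<..} x \<partial>nu)"
    by (intro nn_integral_cong) (auto simp: indicator_def)
  finally show ?thesis
    using nn_integral_nu_pos[of f] nn_integral_nu_pos[of "\<lambda>x. f (- x)"] by simp
qed

lemma integrable_nu_split:
  fixes f :: "real \<Rightarrow> 'b::{banach, second_countable_topology}"
  assumes [measurable]: "f \<in> borel_measurable borel"
    and "integrable lborel (\<lambda>t. f (exp t))" "integrable lborel (\<lambda>t. f (- exp t))"
  shows "integrable nu f"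
proof (rule integrableI_bounded)
  show "(\<integral>\<^sup>+ x. ennreal (norm (f x)) \<partial>nu) < \<infinity>"
    using assms by (subst nn_integral_nu_split) (auto simp: integrable_iff_bounded)
qed simp

text \<open>Under the isomorphism of the nonzero reals with R times Z/2 given by ln|x| and the sign,
  the first factor pairs the logarithms and the second is -1 exactly when both arguments are
  negative.\<close>

definition chi :: "real \<Rightarrow> real \<Rightarrow> complex" where
  "chi x y = cis (- (ln \<bar>x\<bar> * ln \<bar>y\<bar>)) * cis (pi * delta x * delta y)"

lemma delta_measurable [measurable]: "delta \<in> borel_measurable borel"
  unfolding delta_def by measurable

lemma cis_measurable [measurable]: "cis \<in> borel_measurable borel"
  by (intro borel_measurable_continuous_onI continuous_on_cis continuous_on_id)

lemma chi_measurable [measurable (raw)]: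
  assumes [measurable]: "f \<in> borel_measurable M" "g \<in> borel_measurable M"
  shows "(\<lambda>x. chi (f x) (g x)) \<in> borel_measurable M"
  unfolding chi_def by measurable

lemma norm_chi [simp]: "norm (chi x y) = 1"
  by (simp add: chi_def norm_mult)

lemma chi_sym: "chi x y = chi y x"
  by (simp add: chi_def mult_ac)

text \<open>Logarithms add, and the sign exponents \<open>delta\<close> add modulo 2, which is all
  that \<open>cis (pi * ...)\<close> sees.\<close>

lemma chi_mult:
  assumes "a \<noteq> 0" "b \<noteq> 0"
  shows "chi (a * b) y = chi a y * chi b y"
proof -
  have "cis (pi * delta (a * b) * delta y) = cis (pi * delta a * delta y) * cis (pi * delta b * delta y)"
    using assms by (auto simp: delta_def mult_less_0_iff)
  moreover have "ln \<bar>a * b\<bar> = ln \<bar>a\<bar> + ln \<bar>b\<bar>"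
    using assms by (simp add: abs_mult ln_mult)
  ultimately show ?thesis
    by (simp add: chi_def cis_mult algebra_simps)
qed

lemma cnj_chi_mult_chi [simp]: "cnj (chi x y) * chi x y = 1" "chi x y * cnj (chi x y) = 1"
  by (simp_all add: complex_norm_square[symmetric] mult.commute)

lemma chi_divide:
  assumes "a \<noteq> 0" "b \<noteq> 0"
  shows "chi (a / b) y = chi a y * cnj (chi b y)"
  using chi_mult[of "a / b" b y] assms by (simp add: mult.assoc)

lemma Fx_int_eq:
  assumes [measurable]: "u \<in> borel_measurable borel"
  shows "Fx_int u y = (\<integral>x. u x * chi x y \<partial>nu)"
  unfolding nu_def Fx_int_def
  by (subst integral_density)
     (auto simp: winv_def chi_def scaleR_conv_of_real field_simps intro!: Bochner_Integration.integral_cong)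

section \<open>The Gaussian weight and its transform\<close>

definition gaussw :: "real \<Rightarrow> real \<Rightarrow> real" where
  "gaussw n y = exp (- (ln \<bar>y\<bar>)\<^sup>2 / (2 * n\<^sup>2))"

text \<open>This is the transform of \<open>gaussw n\<close>. Each half line contributes the Fourier
  transform n sqrt(2 pi) exp(-n^2 a^2 / 2) of a Gaussian at a = ln|r|. For r > 0 the two
  contributions agree, hence the factor 2; for r < 0 they have opposite signs and cancel.\<close>

definition gaussk :: "real \<Rightarrow> real \<Rightarrow> real" where
  "gaussk n r = (if r > 0 then 2 * n * sqrt (2 * pi) * exp (- n\<^sup>2 * (ln r)\<^sup>2 / 2) else 0)"

lemma gauss_measurable [measurable]:
  "gaussw n \<in> borel_measurable borel" "gaussk n \<in> borel_measurable borel"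
  unfolding gaussw_def gaussk_def by measurable

lemma integrable_gaussian:
  fixes n :: real
  assumes "n > 0"
  shows "integrable lborel (\<lambda>t. exp (- t\<^sup>2 / (2 * n\<^sup>2)))"
proof -
  have "integrable lborel (\<lambda>t. normal_density 0 n t * (n * sqrt (2 * pi)))"
    using assms by (intro integrable_mult_left) auto
  thus ?thesis
    using assms by (simp add: normal_density_def real_sqrt_mult mult.commute)
qed

text \<open>The scaling t = n z reduces the integral to the characteristic function of the standard
  normal distribution.\<close>

lemma gaussian_fourier:
  assumes n: "n > 0"
  shows "(\<integral>t. complex_of_real (exp (- t\<^sup>2 / (2 * n\<^sup>2))) * cis (a * t) \<partial>lborel)
    = complex_of_real (n * sqrt (2 * pi) * exp (- n\<^sup>2 * a\<^sup>2 / 2))"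
proof -
  have "(\<integral>t. complex_of_real (exp (- t\<^sup>2 / (2 * n\<^sup>2))) * cis (a * t) \<partial>lborel)
      = n *\<^sub>R (\<integral>z. complex_of_real (exp (- (n * z)\<^sup>2 / (2 * n\<^sup>2))) * cis (a * (n * z)) \<partial>lborel)"
    using n by (subst lborel_integral_real_affine[where c = n and t = 0]) auto
  also have "\<dots> = n *\<^sub>R (\<integral>z. complex_of_real (sqrt (2 * pi)) * (std_normal_density z *\<^sub>R cis ((n * a) * z)) \<partial>lborel)"
    using n by (intro arg_cong2[of _ _ _ _ scaleR] refl Bochner_Integration.integral_cong)
      (auto simp: std_normal_density_def scaleR_conv_of_real power_mult_distrib mult_ac)
  also have "\<dots> = n *\<^sub>R (complex_of_real (sqrt (2 * pi)) * (\<integral>z. std_normal_density z *\<^sub>R cis ((n * a) * z) \<partial>lborel))"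
    by (simp only: integral_mult_right_zero)
  also have "(\<integral>z. std_normal_density z *\<^sub>R cis ((n * a) * z) \<partial>lborel) = char std_normal_distribution (n * a)"
    unfolding char_def by (subst integral_density) (auto simp: cis_conv_exp normal_density_nonneg)
  finally show ?thesis
    by (simp add: char_std_normal_distribution scaleR_conv_of_real power_mult_distrib)
qed

lemma integrable_gaussw:
  assumes "n > 0"
  shows "integrable nu (gaussw n)"
  using integrable_gaussian[OF assms]
  by (intro integrable_nu_split) (auto simp: gaussw_def)

lemma gaussw_transform:
  assumes n: "n > 0" and r: "r \<noteq> 0"
  shows "(\<integral>y. complex_of_real (gaussw n y) * chi r y \<partial>nu) = complex_of_real (gaussk n r)"
proof -
  have i: "integrable nu (\<lambda>y. complex_of_real (gaussw n y) * chi r y)"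
    using integrable_gaussw[OF n] by (rule Bochner_Integration.integrable_bound) (auto simp: norm_mult)
  have G: "(\<integral>t. complex_of_real (exp (- t\<^sup>2 / (2 * n\<^sup>2))) * cis (- (ln \<bar>r\<bar> * t)) \<partial>lborel)
    = complex_of_real (n * sqrt (2 * pi) * exp (- n\<^sup>2 * (ln \<bar>r\<bar>)\<^sup>2 / 2))"
    using gaussian_fourier[OF n, of "- ln \<bar>r\<bar>"] by simp
  have "(\<integral>y. complex_of_real (gaussw n y) * chi r y \<partial>nu)
      = (\<integral>t. complex_of_real (exp (- t\<^sup>2 / (2 * n\<^sup>2))) * cis (- (ln \<bar>r\<bar> * t)) \<partial>lborel)
      + (\<integral>t. complex_of_real (exp (- t\<^sup>2 / (2 * n\<^sup>2))) * cis (- (ln \<bar>r\<bar> * t)) * cis (pi * delta r) \<partial>lborel)"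
    by (subst integral_nu_split[OF i]) (simp add: gaussw_def chi_def delta_def mult.assoc)
  also have "\<dots> = complex_of_real (n * sqrt (2 * pi) * exp (- n\<^sup>2 * (ln \<bar>r\<bar>)\<^sup>2 / 2)) * (1 + cis (pi * delta r))"
    by (subst integral_mult_left_zero) (simp only: G distrib_left mult_1_right)
  also have "\<dots> = complex_of_real (gaussk n r)"
    using r by (auto simp: gaussk_def delta_def)
  finally show ?thesis .
qed

lemma gaussk_nonneg [simp]: "n > 0 \<Longrightarrow> gaussk n r \<ge> 0"
  by (simp add: gaussk_def)

text \<open>In probabilistic terms, \<open>gaussk n\<close> is \<open>4 * pi\<close> times the law
  of exp(Z / n) with Z standard normal: substitute r = exp(z / n) and use 2 sqrt(2 pi) = 4 pi /
  sqrt(2 pi). The dependence on \<open>n\<close> moves from the kernel into the dilation, as the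
  dominated convergence argument for \<open>n\<close> tending to infinity requires.\<close>

lemma nn_integral_gaussk_mult:
  assumes n: "n > 0" and [measurable]: "f \<in> borel_measurable borel"
  shows "(\<integral>\<^sup>+r. ennreal (gaussk n r) * f r \<partial>nu)
     = ennreal (4 * pi) * (\<integral>\<^sup>+z. ennreal (std_normal_density z) * f (exp (z / n)) \<partial>lborel)"
proof -
  have "(\<integral>\<^sup>+r. ennreal (gaussk n r) * f r \<partial>nu)
      = (\<integral>\<^sup>+t. ennreal (2 * n * sqrt (2 * pi) * exp (- n\<^sup>2 * t\<^sup>2 / 2)) * f (exp t) \<partial>lborel)"
    by (subst nn_integral_nu_split) (auto simp: gaussk_def)
  also have "\<dots> = ennreal (1 / n) *
      (\<integral>\<^sup>+z. ennreal (2 * n * sqrt (2 * pi) * exp (- z\<^sup>2 / 2)) * f (exp (z / n)) \<partial>lborel)"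
    using n by (subst nn_integral_real_affine[where c = "1 / n" and t = 0]) (auto simp: power_divide)
  also have "\<dots> = (\<integral>\<^sup>+z. ennreal (1 / n) * (ennreal (2 * n * sqrt (2 * pi) * exp (- z\<^sup>2 / 2)) * f (exp (z / n))) \<partial>lborel)"
    by (rule nn_integral_cmult[symmetric]) measurable
  also have "\<dots> = (\<integral>\<^sup>+z. ennreal (4 * pi) * (ennreal (std_normal_density z) * f (exp (z / n))) \<partial>lborel)"
  proof (rule nn_integral_cong)
    fix z :: real
    have "sqrt (2 * pi) * sqrt (2 * pi) = 2 * pi" by simp
    hence "1 / n * (2 * n * sqrt (2 * pi) * exp (- z\<^sup>2 / 2)) = 4 * pi * std_normal_density z"
      using n unfolding std_normal_density_def by (simp add: field_simps)
    hence "ennreal (1 / n) * ennreal (2 * n * sqrt (2 * pi) * exp (- z\<^sup>2 / 2)) = ennreal (4 * pi) * ennreal (std_normal_density z)"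
      using n by (subst (1 2) ennreal_mult[symmetric]) (auto simp: normal_density_nonneg)
    thus "ennreal (1 / n) * (ennreal (2 * n * sqrt (2 * pi) * exp (- z\<^sup>2 / 2)) * f (exp (z / n)))
       = ennreal (4 * pi) * (ennreal (std_normal_density z) * f (exp (z / n)))"
      by (simp only: mult.assoc[symmetric])
  qed
  also have "\<dots> = ennreal (4 * pi) * (\<integral>\<^sup>+z. ennreal (std_normal_density z) * f (exp (z / n)) \<partial>lborel)"
    by (rule nn_integral_cmult) measurable
  finally show ?thesis .
qed

lemma nn_integral_gaussk:
  assumes "n > 0"
  shows "(\<integral>\<^sup>+r. ennreal (gaussk n r) \<partial>nu) = ennreal (4 * pi)"
proof -
  have "(\<integral>\<^sup>+z. ennreal (std_normal_density z) \<partial>lborel) = 1"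
    by (subst nn_integral_eq_integral) (auto simp: normal_density_nonneg integral_normal_density)
  thus ?thesis using nn_integral_gaussk_mult[OF assms, of "\<lambda>_. 1"] by simp
qed

lemma integrable_gaussk: "n > 0 \<Longrightarrow> integrable nu (gaussk n)"
  by (intro integrableI_bounded) (auto simp: nn_integral_gaussk)

section \<open>Multiplicative convolutions on \<open>L2\<close>\<close>

lemma (in pair_sigma_finite) Fubini_integral_nn:
  fixes f :: "'a \<Rightarrow> 'b \<Rightarrow> 'c::{banach, second_countable_topology}"
  assumes f: "case_prod f \<in> borel_measurable (M1 \<Otimes>\<^sub>M M2)"
    and fin: "(\<integral>\<^sup>+y. (\<integral>\<^sup>+x. ennreal (norm (f x y)) \<partial>M1) \<partial>M2) < \<infinity>"
  shows "(\<integral>y. (\<integral>x. f x y \<partial>M1) \<partial>M2) = (\<integral>x. (\<integral>y. f x y \<partial>M2) \<partial>M1)"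
proof (rule Fubini_integral)
  have [measurable]: "(\<lambda>p. ennreal (norm (case_prod f p))) \<in> borel_measurable (M1 \<Otimes>\<^sub>M M2)"
    using f by measurable
  show "integrable (M1 \<Otimes>\<^sub>M M2) (case_prod f)"
  proof (rule integrableI_bounded[OF f])
    have "(\<integral>\<^sup>+p. ennreal (norm (case_prod f p)) \<partial>(M1 \<Otimes>\<^sub>M M2))
        = (\<integral>\<^sup>+y. (\<integral>\<^sup>+x. ennreal (norm (case_prod f (x, y))) \<partial>M1) \<partial>M2)"
      by (rule nn_integral_snd[symmetric]) measurable
    thus "(\<integral>\<^sup>+p. ennreal (norm (case_prod f p)) \<partial>(M1 \<Otimes>\<^sub>M M2)) < \<infinity>"
      using fin by simp
  qed
qed

text \<open>When \<open>f\<close> is not integrable the Bochner integral is 0 and the bound is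
  trivial. Pointwise estimates of averages therefore hold at every point.\<close>

lemma norm_integral_le_nn_integral:
  fixes f :: "'a \<Rightarrow> 'b::{banach, second_countable_topology}"
  shows "ennreal (norm (\<integral>x. f x \<partial>M)) \<le> (\<integral>\<^sup>+x. ennreal (norm (f x)) \<partial>M)"
  by (cases "integrable M f") (auto simp: integral_norm_bound_ennreal not_integrable_integral_eq)

text \<open>The squared L2 norm is kept in \<open>ennreal\<close>, so that infinite values are
  allowed and no square roots occur. The price is the form 2 a + 2 b of the triangle inequality, the
  source of the divisions by 4 in later epsilon arguments.\<close>

definition nrm2 :: "(real \<Rightarrow> complex) \<Rightarrow> ennreal" where
  "nrm2 u = (\<integral>\<^sup>+x. ennreal ((cmod (u x))\<^sup>2) \<partial>nu)"

lemma nrm2_cong_AE: "AE x in nu. cmod (u x) = cmod (v x) \<Longrightarrow> nrm2 u = nrm2 v"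
  unfolding nrm2_def by (rule nn_integral_cong_AE) auto

lemma nrm2_mono_AE: "AE x in nu. cmod (u x) \<le> cmod (v x) \<Longrightarrow> nrm2 u \<le> nrm2 v"
  unfolding nrm2_def by (rule nn_integral_mono_AE) (auto intro!: ennreal_leI power_mono)

lemma nrm2_cmult:
  assumes [measurable]: "u \<in> borel_measurable borel"
  shows "nrm2 (\<lambda>x. a * u x) = ennreal ((cmod a)\<^sup>2) * nrm2 u"
  unfolding nrm2_def
  by (subst nn_integral_cmult[symmetric]) (auto simp: norm_mult power_mult_distrib ennreal_mult')

lemma nrm2_commute: "nrm2 (\<lambda>x. u x - v x) = nrm2 (\<lambda>x. v x - u x)"
  by (rule nrm2_cong_AE) (simp add: norm_minus_commute)

lemma nrm2_add_le:
  assumes [measurable]: "u \<in> borel_measurable borel" "v \<in> borel_measurable borel"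
  shows "nrm2 (\<lambda>x. u x + v x) \<le> 2 * nrm2 u + 2 * nrm2 v"
proof -
  have "nrm2 (\<lambda>x. u x + v x)
      \<le> (\<integral>\<^sup>+x. 2 * ennreal ((cmod (u x))\<^sup>2) + 2 * ennreal ((cmod (v x))\<^sup>2) \<partial>nu)"
    unfolding nrm2_def
  proof (rule nn_integral_mono)
    fix x
    have "(cmod (u x + v x))\<^sup>2 \<le> (cmod (u x) + cmod (v x))\<^sup>2"
      by (intro power_mono norm_triangle_ineq) auto
    also have "\<dots> \<le> 2 * (cmod (u x))\<^sup>2 + 2 * (cmod (v x))\<^sup>2"
      using sum_squares_bound[of "cmod (u x)" "cmod (v x)"] by (simp add: power2_sum)
    finally have "ennreal ((cmod (u x + v x))\<^sup>2) \<le> ennreal (2 * (cmod (u x))\<^sup>2 + 2 * (cmod (v x))\<^sup>2)"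
      by (rule ennreal_leI)
    thus "ennreal ((cmod (u x + v x))\<^sup>2) \<le> 2 * ennreal ((cmod (u x))\<^sup>2) + 2 * ennreal ((cmod (v x))\<^sup>2)"
      by (simp add: ennreal_mult')
  qed
  also have "\<dots> = 2 * nrm2 u + 2 * nrm2 v"
    unfolding nrm2_def by (subst nn_integral_add) (auto simp: nn_integral_cmult)
  finally show ?thesis .
qed

lemma nrm2_triangle:
  assumes [measurable]: "u \<in> borel_measurable borel" "v \<in> borel_measurable borel" "w \<in> borel_measurable borel"
  shows "nrm2 (\<lambda>x. u x - w x) \<le> 2 * nrm2 (\<lambda>x. u x - v x) + 2 * nrm2 (\<lambda>x. v x - w x)"
  using nrm2_add_le[of "\<lambda>x. u x - v x" "\<lambda>x. v x - w x"] by simp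

lemma nrm2_finite_if_close:
  assumes [measurable]: "u \<in> borel_measurable borel" "v \<in> borel_measurable borel"
    and "nrm2 v < \<infinity>" "nrm2 (\<lambda>x. u x - v x) < \<infinity>"
  shows "nrm2 u < \<infinity>"
proof -
  have "nrm2 (\<lambda>x. u x - 0) \<le> 2 * nrm2 (\<lambda>x. u x - v x) + 2 * nrm2 (\<lambda>x. v x - 0)"
    by (rule nrm2_triangle) auto
  also have "\<dots> < \<infinity>"
    using assms(3,4) by (simp add: ennreal_mult_less_top)
  finally show ?thesis by simp
qed

lemma AE_eq_if_nrm2_eq_0:
  assumes [measurable]: "u \<in> borel_measurable borel" "v \<in> borel_measurable borel"
    and "nrm2 (\<lambda>x. u x - v x) = 0"
  shows "AE x in nu. u x = v x"
proof -
  have "AE x in nu. ennreal ((cmod (u x - v x))\<^sup>2) = 0"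
    using assms(3) unfolding nrm2_def by (subst (asm) nn_integral_0_iff_AE) auto
  thus ?thesis by eventually_elim (simp add: ennreal_eq_0_iff)
qed

text \<open>Weighted averages of dilations occur twice: with the kernel \<open>gaussk n\<close> over
  \<open>nu\<close> and \<open>h\<close> the identity, and with the kernel built from
  \<open>g\<close> and \<open>h\<close> over Lebesgue measure. \<open>h_nonzero\<close> ensures that
  every dilation carrying weight is invertible, so that the invariance of \<open>nu\<close> applies
  to it.\<close>

locale mconv = S: sigma_finite_measure S for S :: "'s measure" +
  fixes k :: "'s \<Rightarrow> complex" and h :: "'s \<Rightarrow> real"
  assumes k_integrable: "integrable S k"
    and h_measurable [measurable]: "h \<in> borel_measurable S"
    and h_nonzero: "k s \<noteq> 0 \<Longrightarrow> h s \<noteq> 0"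
begin

sublocale P: pair_sigma_finite S nu ..

lemma k_measurable [measurable]: "k \<in> borel_measurable S"
  using k_integrable by auto

definition mass :: ennreal where
  "mass = (\<integral>\<^sup>+s. ennreal (norm (k s)) \<partial>S)"

lemma mass_finite: "mass < \<infinity>"
  using k_integrable unfolding mass_def integrable_iff_bounded by simp

definition conv :: "(real \<Rightarrow> complex) \<Rightarrow> real \<Rightarrow> complex" where
  "conv u x = (\<integral>s. k s * u (h s * x) \<partial>S)"

text \<open>The majorant of \<open>conv\<close> by absolute values; as an \<open>ennreal\<close>
  integral it is meaningful even where the average diverges.\<close>

definition aconv :: "(real \<Rightarrow> ennreal) \<Rightarrow> real \<Rightarrow> ennreal" where
  "aconv f x = (\<integral>\<^sup>+s. ennreal (norm (k s)) * f (h s * x) \<partial>S)"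

lemma conv_measurable [measurable]:
  assumes [measurable]: "u \<in> borel_measurable borel"
  shows "conv u \<in> borel_measurable borel"
  unfolding conv_def by measurable

lemma aconv_measurable [measurable]:
  assumes [measurable]: "f \<in> borel_measurable borel"
  shows "aconv f \<in> borel_measurable borel"
  unfolding aconv_def by measurable

text \<open>By Tonelli the \<open>x\<close> integral may be taken first, and each dilation with
  nonzero weight preserves \<open>nu\<close>, so only the total weight remains. This is the L1
  bound.\<close>

lemma nn_integral_aconv:
  assumes [measurable]: "f \<in> borel_measurable borel"
  shows "(\<integral>\<^sup>+x. aconv f x \<partial>nu) = mass * (\<integral>\<^sup>+x. f x \<partial>nu)"
proof -
  have "(\<integral>\<^sup>+x. aconv f x \<partial>nu) = (\<integral>\<^sup>+s. (\<integral>\<^sup>+x. ennreal (norm (k s)) * f (h s * x) \<partial>nu) \<partial>S)"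
    unfolding aconv_def by (rule P.Fubini') measurable
  also have "\<dots> = (\<integral>\<^sup>+s. ennreal (norm (k s)) * (\<integral>\<^sup>+x. f x \<partial>nu) \<partial>S)"
  proof (rule nn_integral_cong)
    fix s
    show "(\<integral>\<^sup>+x. ennreal (norm (k s)) * f (h s * x) \<partial>nu) = ennreal (norm (k s)) * (\<integral>\<^sup>+x. f x \<partial>nu)"
    proof (cases "k s = 0")
      case False
      have "(\<integral>\<^sup>+x. ennreal (norm (k s)) * f (h s * x) \<partial>nu) = ennreal (norm (k s)) * (\<integral>\<^sup>+x. f (h s * x) \<partial>nu)"
        by (rule nn_integral_cmult) measurable
      with nn_integral_nu_mult[OF h_nonzero[OF False], of f] show ?thesis by simp
    qed simp
  qed
  also have "\<dots> = mass * (\<integral>\<^sup>+x. f x \<partial>nu)"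
    unfolding mass_def by (rule nn_integral_multc) measurable
  finally show ?thesis .
qed

lemma norm_conv_le: "ennreal (norm (conv u x)) \<le> aconv (\<lambda>x. ennreal (norm (u x))) x"
  unfolding conv_def aconv_def
  using norm_integral_le_nn_integral[of S "\<lambda>s. k s * u (h s * x)"]
  by (simp add: norm_mult ennreal_mult')

text \<open>Split |k| into sqrt|k| times sqrt|k| and apply Cauchy-Schwarz in \<open>s\<close>.
  Integrating over \<open>x\<close> then gives the L2 bound with operator norm at most
  \<open>mass\<close>.\<close>

lemma aconv_square_le:
  assumes [measurable]: "f \<in> borel_measurable borel"
  shows "(aconv f x)\<^sup>2 \<le> mass * aconv (\<lambda>x. (f x)\<^sup>2) x"
proof -
  have sq: "(ennreal (sqrt (norm (k s))))\<^sup>2 = ennreal (norm (k s))" for s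
    by (simp add: ennreal_power)
  have "aconv f x = (\<integral>\<^sup>+s. ennreal (sqrt (norm (k s))) * (ennreal (sqrt (norm (k s))) * f (h s * x)) \<partial>S)"
    unfolding aconv_def sq[symmetric] by (simp add: power2_eq_square mult.assoc)
  hence "(aconv f x)\<^sup>2 \<le> (\<integral>\<^sup>+s. (ennreal (sqrt (norm (k s))))\<^sup>2 \<partial>S)
      * (\<integral>\<^sup>+s. (ennreal (sqrt (norm (k s))) * f (h s * x))\<^sup>2 \<partial>S)"
    by (simp only:) (rule Cauchy_Schwarz_nn_integral; measurable)
  thus ?thesis
    by (simp add: power_mult_distrib sq mass_def aconv_def)
qed

lemma nn_integral_aconv_square:
  assumes [measurable]: "f \<in> borel_measurable borel"
  shows "(\<integral>\<^sup>+x. (aconv f x)\<^sup>2 \<partial>nu) \<le> mass\<^sup>2 * (\<integral>\<^sup>+x. (f x)\<^sup>2 \<partial>nu)"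
proof -
  have "(\<integral>\<^sup>+x. (aconv f x)\<^sup>2 \<partial>nu) \<le> (\<integral>\<^sup>+x. mass * aconv (\<lambda>x. (f x)\<^sup>2) x \<partial>nu)"
    by (intro nn_integral_mono aconv_square_le) measurable
  also have "\<dots> = mass * (\<integral>\<^sup>+x. aconv (\<lambda>x. (f x)\<^sup>2) x \<partial>nu)"
    by (rule nn_integral_cmult) measurable
  finally show ?thesis
    by (simp add: nn_integral_aconv power2_eq_square mult.assoc)
qed

lemma nrm2_conv_le:
  assumes [measurable]: "u \<in> borel_measurable borel"
  shows "nrm2 (conv u) \<le> mass\<^sup>2 * nrm2 u"
proof -
  have "nrm2 (conv u) \<le> (\<integral>\<^sup>+x. (aconv (\<lambda>x. ennreal (norm (u x))) x)\<^sup>2 \<partial>nu)"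
    unfolding nrm2_def
    by (intro nn_integral_mono) (simp add: ennreal_power[symmetric] norm_conv_le power_mono)
  also have "\<dots> \<le> mass\<^sup>2 * (\<integral>\<^sup>+x. (ennreal (norm (u x)))\<^sup>2 \<partial>nu)"
    by (rule nn_integral_aconv_square) measurable
  finally show ?thesis by (simp add: nrm2_def ennreal_power)
qed

lemma integrable_conv:
  assumes "integrable nu u"
  shows "integrable nu (conv u)"
proof (rule integrableI_bounded)
  have [measurable]: "u \<in> borel_measurable borel"
    using assms by (auto dest: borel_measurable_integrable)
  show "conv u \<in> borel_measurable nu" by measurable
  have "(\<integral>\<^sup>+x. ennreal (norm (conv u x)) \<partial>nu) \<le> (\<integral>\<^sup>+x. aconv (\<lambda>x. ennreal (norm (u x))) x \<partial>nu)"
    by (intro nn_integral_mono norm_conv_le)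
  also have "\<dots> = mass * (\<integral>\<^sup>+x. ennreal (norm (u x)) \<partial>nu)"
    by (rule nn_integral_aconv) measurable
  also have "\<dots> < \<infinity>"
    using assms mass_finite by (auto simp: integrable_iff_bounded ennreal_mult_less_top)
  finally show "(\<integral>\<^sup>+x. ennreal (norm (conv u x)) \<partial>nu) < \<infinity>" .
qed

text \<open>The majorant \<open>aconv\<close> of an L2 function is square integrable, hence finite
  almost everywhere. This is what makes \<open>conv\<close> additive almost everywhere on
  L2.\<close>

lemma AE_conv_integrable:
  assumes [measurable]: "u \<in> borel_measurable borel" and "nrm2 u < \<infinity>"
  shows "AE x in nu. integrable S (\<lambda>s. k s * u (h s * x))"
proof -
  have "(\<integral>\<^sup>+x. (aconv (\<lambda>x. ennreal (norm (u x))) x)\<^sup>2 \<partial>nu) \<le> mass\<^sup>2 * nrm2 u"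
    using nn_integral_aconv_square[of "\<lambda>x. ennreal (norm (u x))"]
    by (simp add: nrm2_def ennreal_power)
  also have "\<dots> < \<infinity>"
    using assms(2) mass_finite by (simp add: ennreal_mult_less_top power_less_top_ennreal)
  finally have "AE x in nu. (aconv (\<lambda>x. ennreal (norm (u x))) x)\<^sup>2 \<noteq> \<infinity>"
    by (intro nn_integral_PInf_AE) auto
  thus ?thesis
  proof eventually_elim
    fix x assume "(aconv (\<lambda>x. ennreal (norm (u x))) x)\<^sup>2 \<noteq> \<infinity>"
    hence "aconv (\<lambda>x. ennreal (norm (u x))) x < \<infinity>"
      by (auto simp: less_top[symmetric] power2_eq_square)
    thus "integrable S (\<lambda>s. k s * u (h s * x))"
      by (intro integrableI_bounded) (auto simp: aconv_def norm_mult ennreal_mult')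
  qed
qed

lemma nrm2_conv_diff_le:
  assumes [measurable]: "u \<in> borel_measurable borel" "v \<in> borel_measurable borel"
    and "nrm2 u < \<infinity>" "nrm2 v < \<infinity>"
  shows "nrm2 (\<lambda>x. conv u x - conv v x) \<le> mass\<^sup>2 * nrm2 (\<lambda>x. u x - v x)"
proof -
  have "AE x in nu. conv u x - conv v x = conv (\<lambda>x. u x - v x) x"
    using AE_conv_integrable[OF assms(1,3)] AE_conv_integrable[OF assms(2,4)]
    by eventually_elim (simp add: conv_def right_diff_distrib)
  hence "nrm2 (\<lambda>x. conv u x - conv v x) = nrm2 (conv (\<lambda>x. u x - v x))"
    by (intro nrm2_cong_AE) auto
  thus ?thesis using nrm2_conv_le[of "\<lambda>x. u x - v x"] by simp
qed

text \<open>The conjugate comes from rewriting \<open>chi x y\<close> as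
  \<open>cnj (chi (h s) y) * chi (h s * x) y\<close> before substituting for \<open>h s * x\<close>.
  For the operator of the theorem this is \<open>mu\<close> off 0.\<close>

definition symbol :: "real \<Rightarrow> complex" where
  "symbol y = (\<integral>s. k s * cnj (chi (h s) y) \<partial>S)"

lemma Fx_int_conv:
  assumes u: "integrable nu u"
  shows "Fx_int (conv u) y = symbol y * Fx_int u y"
proof -
  have [measurable]: "u \<in> borel_measurable borel"
    using u by (auto dest: borel_measurable_integrable)
  have "Fx_int (conv u) y = (\<integral>x. (\<integral>s. k s * u (h s * x) * chi x y \<partial>S) \<partial>nu)"
    by (subst Fx_int_eq, measurable) (simp only: conv_def integral_mult_left_zero[symmetric])
  also have "\<dots> = (\<integral>s. (\<integral>x. k s * u (h s * x) * chi x y \<partial>nu) \<partial>S)"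
  proof (rule P.Fubini_integral_nn)
    have "(\<integral>\<^sup>+x. (\<integral>\<^sup>+s. ennreal (norm (k s * u (h s * x) * chi x y)) \<partial>S) \<partial>nu)
        = (\<integral>\<^sup>+x. aconv (\<lambda>x. ennreal (norm (u x))) x \<partial>nu)"
      by (simp add: aconv_def norm_mult ennreal_mult')
    also have "\<dots> = mass * (\<integral>\<^sup>+x. ennreal (norm (u x)) \<partial>nu)"
      by (rule nn_integral_aconv) measurable
    also have "\<dots> < \<infinity>"
      using u mass_finite by (auto simp: integrable_iff_bounded ennreal_mult_less_top)
    finally show "(\<integral>\<^sup>+x. (\<integral>\<^sup>+s. ennreal (norm (k s * u (h s * x) * chi x y)) \<partial>S) \<partial>nu) < \<infinity>" .
  qed measurable
  also have "\<dots> = (\<integral>s. k s * cnj (chi (h s) y) * Fx_int u y \<partial>S)"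
  proof (rule Bochner_Integration.integral_cong)
    fix s
    show "(\<integral>x. k s * u (h s * x) * chi x y \<partial>nu) = k s * cnj (chi (h s) y) * Fx_int u y"
    proof (cases "k s = 0")
      case False
      hence nz: "h s \<noteq> 0" by (rule h_nonzero)
      have "(\<integral>x. k s * u (h s * x) * chi x y \<partial>nu)
          = (\<integral>x. (k s * cnj (chi (h s) y)) * (u (h s * x) * chi (h s * x) y) \<partial>nu)"
      proof (rule integral_cong_AE)
        show "AE x in nu. k s * u (h s * x) * chi x y
            = (k s * cnj (chi (h s) y)) * (u (h s * x) * chi (h s * x) y)"
          using AE_nu_nonzero
        proof eventually_elim
          case (elim x)
          have "cnj (chi (h s) y) * chi (h s * x) y = chi x y"
            using nz elim by (simp add: chi_mult mult.assoc[symmetric])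
          thus ?case by (simp add: mult_ac)
        qed
      qed measurable
      also have "\<dots> = (k s * cnj (chi (h s) y)) * (\<integral>x. u (h s * x) * chi (h s * x) y \<partial>nu)"
        by (rule integral_mult_right_zero)
      also have "(\<integral>x. u (h s * x) * chi (h s * x) y \<partial>nu) = (\<integral>x. u x * chi x y \<partial>nu)"
        using nz by (rule integral_nu_mult[of _ "\<lambda>x. u x * chi x y"]) measurable
      finally show ?thesis by (simp add: Fx_int_eq)
    qed simp
  qed simp
  also have "\<dots> = symbol y * Fx_int u y"
    unfolding symbol_def by (rule integral_mult_left_zero)
  finally show ?thesis .
qed

lemma norm_symbol_le: "norm (symbol y) \<le> enn2real mass"
proof -
  have "ennreal (norm (symbol y)) \<le> mass"
    unfolding symbol_def mass_def
    using norm_integral_le_nn_integral[of S "\<lambda>s. k s * cnj (chi (h s) y)"] by (simp add: norm_mult)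
  thus ?thesis using mass_finite by (cases mass) auto
qed

end

section \<open>The transform on \<open>L1 \<inter> L2\<close>\<close>

interpretation nunu: pair_sigma_finite nu nu ..

lemma cnj_measurable [measurable]: "cnj \<in> borel_measurable borel"
  by (intro borel_measurable_continuous_onI continuous_on_cnj continuous_on_id)

lemma integrable_nu_measurable: "integrable nu f \<Longrightarrow> f \<in> borel_measurable borel"
  by (auto dest: borel_measurable_integrable)

lemma Fx_int_measurable [measurable]:
  assumes [measurable]: "u \<in> borel_measurable borel"
  shows "Fx_int u \<in> borel_measurable borel"
proof -
  have "Fx_int u = (\<lambda>y. \<integral>x. u x * chi x y \<partial>nu)"
    by (simp add: Fx_int_eq[OF assms] fun_eq_iff)
  thus ?thesis by simp
qed

lemma integrable_mult_chi:
  assumes u: "integrable nu u"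
  shows "integrable nu (\<lambda>x. u x * chi x y)" "integrable nu (\<lambda>x. u x * cnj (chi y x))"
proof -
  have [measurable]: "u \<in> borel_measurable borel" by (rule integrable_nu_measurable[OF u])
  show "integrable nu (\<lambda>x. u x * chi x y)"
    by (rule Bochner_Integration.integrable_bound[OF u]) (measurable, simp add: norm_mult)
  show "integrable nu (\<lambda>x. u x * cnj (chi y x))"
    by (rule Bochner_Integration.integrable_bound[OF u]) (measurable, simp add: norm_mult)
qed

lemma norm_Fx_int_le:
  assumes u: "integrable nu u"
  shows "norm (Fx_int u y) \<le> (\<integral>x. norm (u x) \<partial>nu)"
proof -
  have "norm (\<integral>x. u x * chi x y \<partial>nu) \<le> (\<integral>x. norm (u x * chi x y) \<partial>nu)"
    by (rule integral_norm_bound)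
  thus ?thesis using u by (simp add: Fx_int_eq integrable_nu_measurable norm_mult)
qed

lemma Fx_int_diff:
  assumes u: "integrable nu u" and v: "integrable nu v"
  shows "Fx_int (\<lambda>x. u x - v x) y = Fx_int u y - Fx_int v y"
proof -
  note [measurable] = integrable_nu_measurable[OF u] integrable_nu_measurable[OF v]
  show ?thesis
    using Bochner_Integration.integral_diff[OF integrable_mult_chi(1)[OF u] integrable_mult_chi(1)[OF v], of y y]
    by (simp add: Fx_int_eq left_diff_distrib)
qed

lemma Fx_int_cmult:
  assumes [measurable]: "u \<in> borel_measurable borel"
  shows "Fx_int (\<lambda>x. a * u x) y = a * Fx_int u y"
  by (simp add: Fx_int_eq mult.assoc)

definition Fx_adj :: "(real \<Rightarrow> complex) \<Rightarrow> real \<Rightarrow> complex" where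
  "Fx_adj g x = (\<integral>y. g y * cnj (chi x y) \<partial>nu)"

lemma Fx_adj_measurable [measurable]:
  assumes [measurable]: "u \<in> borel_measurable borel"
  shows "Fx_adj u \<in> borel_measurable borel"
  unfolding Fx_adj_def by measurable

text \<open>The kernel is symmetric, so the adjoint is the transform conjugated on both sides.
  Bounds and inversion formulas for one of them thereby pass to the other.\<close>

lemma Fx_adj_eq_cnj:
  assumes [measurable]: "g \<in> borel_measurable borel"
  shows "Fx_adj g x = cnj (Fx_int (\<lambda>y. cnj (g y)) x)"
proof -
  have "Fx_int (\<lambda>y. cnj (g y)) x = (\<integral>y. cnj (g y * cnj (chi x y)) \<partial>nu)"
    by (simp add: Fx_int_eq chi_sym[of x])
  thus ?thesis by (simp only: Bochner_Integration.integral_cnj Fx_adj_def complex_cnj_cnj)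
qed

lemma Fx_adj_diff:
  assumes u: "integrable nu u" and v: "integrable nu v"
  shows "Fx_adj (\<lambda>x. u x - v x) y = Fx_adj u y - Fx_adj v y"
  using Bochner_Integration.integral_diff[OF integrable_mult_chi(2)[OF u] integrable_mult_chi(2)[OF v], of y y]
  by (simp add: Fx_adj_def left_diff_distrib)

lemma adjoint_Fx_int:
  assumes f: "integrable nu f" and g: "integrable nu g"
  shows "(\<integral>y. g y * cnj (Fx_int f y) \<partial>nu) = (\<integral>x. Fx_adj g x * cnj (f x) \<partial>nu)"
proof -
  note [measurable] = integrable_nu_measurable[OF f] integrable_nu_measurable[OF g]
  have "(\<integral>y. g y * cnj (Fx_int f y) \<partial>nu) = (\<integral>y. (\<integral>x. g y * cnj (f x) * cnj (chi x y) \<partial>nu) \<partial>nu)"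
    by (simp add: Fx_int_eq mult.assoc flip: Bochner_Integration.integral_cnj)
  also have "\<dots> = (\<integral>x. (\<integral>y. g y * cnj (f x) * cnj (chi x y) \<partial>nu) \<partial>nu)"
  proof (rule nunu.Fubini_integral_nn)
    have "(\<integral>\<^sup>+y. (\<integral>\<^sup>+x. ennreal (norm (g y * cnj (f x) * cnj (chi x y))) \<partial>nu) \<partial>nu)
        = (\<integral>\<^sup>+y. ennreal (norm (g y)) \<partial>nu) * (\<integral>\<^sup>+x. ennreal (norm (f x)) \<partial>nu)"
      by (simp add: norm_mult ennreal_mult' nn_integral_cmult nn_integral_multc)
    also have "\<dots> < \<infinity>"
      using f g by (auto simp: integrable_iff_bounded ennreal_mult_less_top)
    finally show "(\<integral>\<^sup>+y. (\<integral>\<^sup>+x. ennreal (norm (g y * cnj (f x) * cnj (chi x y))) \<partial>nu) \<partial>nu) < \<infinity>" .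
  qed measurable
  also have "\<dots> = (\<integral>x. (\<integral>y. (g y * cnj (chi x y)) * cnj (f x) \<partial>nu) \<partial>nu)"
    by (simp add: mult_ac)
  also have "\<dots> = (\<integral>x. Fx_adj g x * cnj (f x) \<partial>nu)"
    by (simp only: Fx_adj_def integral_mult_left_zero)
  finally show ?thesis .
qed

section \<open>Gaussian damping: inversion formula and L2 bound\<close>

lemma mconv_gaussk:
  assumes "n > 0"
  shows "mconv nu (\<lambda>r. complex_of_real (gaussk n r)) (\<lambda>r. r)"
proof unfold_locales
  show "integrable nu (\<lambda>r. complex_of_real (gaussk n r))"
    using integrable_gaussk[OF assms] by simp
  show "complex_of_real (gaussk n r) \<noteq> 0 \<Longrightarrow> r \<noteq> 0" for r
    by (auto simp: gaussk_def)
qed simp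

text \<open>Stated outside the locale, so that it can be formed for every \<open>n\<close>; it
  agrees with the locale's \<open>conv\<close> for positive \<open>n\<close>.\<close>

definition gconv :: "real \<Rightarrow> (real \<Rightarrow> complex) \<Rightarrow> real \<Rightarrow> complex" where
  "gconv n u x = (\<integral>r. complex_of_real (gaussk n r) * u (r * x) \<partial>nu)"

lemma gconv_eq_conv:
  "n > 0 \<Longrightarrow> gconv n = mconv.conv nu (\<lambda>r. complex_of_real (gaussk n r)) (\<lambda>r. r)"
  by (simp add: fun_eq_iff gconv_def mconv.conv_def[OF mconv_gaussk])

lemma gconv_measurable [measurable]:
  assumes [measurable]: "u \<in> borel_measurable borel"
  shows "gconv n u \<in> borel_measurable borel"
  unfolding gconv_def by measurable

lemma mass_gaussk:
  assumes "n > 0"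
  shows "mconv.mass nu (\<lambda>r. complex_of_real (gaussk n r)) = ennreal (4 * pi)"
  using nn_integral_gaussk[OF assms] assms by (simp add: mconv.mass_def[OF mconv_gaussk])

lemma nrm2_gconv_le:
  assumes n: "n > 0" and "u \<in> borel_measurable borel"
  shows "nrm2 (gconv n u) \<le> ennreal ((4 * pi)\<^sup>2) * nrm2 u"
  using mconv.nrm2_conv_le[OF mconv_gaussk[OF n] assms(2)]
  unfolding gconv_eq_conv[OF n] mass_gaussk[OF n] by (simp add: ennreal_power)

text \<open>Applied to transforms of integrable functions, which are bounded, this makes their
  damped versions legitimate inputs for the opposite transform.\<close>

lemma integrable_gaussw_mult:
  assumes n: "n > 0" and [measurable]: "v \<in> borel_measurable borel" and B: "\<And>y. norm (v y) \<le> B"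
  shows "integrable nu (\<lambda>y. complex_of_real (gaussw n y) * v y)"
proof (rule Bochner_Integration.integrable_bound)
  show "integrable nu (\<lambda>y. B * gaussw n y)"
    using integrable_gaussw[OF n] by simp
  show "AE y in nu. norm (complex_of_real (gaussw n y) * v y) \<le> norm (B * gaussw n y)"
  proof (rule AE_I2)
    fix y
    have "B \<ge> 0" using B[of y] norm_ge_zero[of "v y"] by linarith
    thus "norm (complex_of_real (gaussw n y) * v y) \<le> norm (B * gaussw n y)"
      using mult_right_mono[OF B[of y], of "gaussw n y"] by (simp add: norm_mult abs_mult gaussw_def mult.commute)
  qed
qed measurable

text \<open>After Fubini the two characters combine to \<open>chi (x' / x) y\<close>, so the inner
  integral is the Gaussian kernel at \<open>x' / x\<close>. The substitution x' = x r turns the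
  outer integral into an average of dilations.\<close>

lemma Fx_adj_gaussw_Fx_int:
  assumes n: "n > 0" and f: "integrable nu f" and x: "x \<noteq> 0"
  shows "Fx_adj (\<lambda>y. complex_of_real (gaussw n y) * Fx_int f y) x = gconv n f x"
proof -
  note [measurable] = integrable_nu_measurable[OF f]
  have "Fx_adj (\<lambda>y. complex_of_real (gaussw n y) * Fx_int f y) x
      = (\<integral>y. (\<integral>x'. f x' * (complex_of_real (gaussw n y) * (chi x' y * cnj (chi x y))) \<partial>nu) \<partial>nu)"
    unfolding Fx_adj_def
  proof (rule Bochner_Integration.integral_cong)
    fix y
    have "(\<integral>x'. f x' * (complex_of_real (gaussw n y) * (chi x' y * cnj (chi x y))) \<partial>nu)
        = (\<integral>x'. (complex_of_real (gaussw n y) * cnj (chi x y)) * (f x' * chi x' y) \<partial>nu)"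
      by (simp add: mult_ac)
    also have "\<dots> = complex_of_real (gaussw n y) * cnj (chi x y) * Fx_int f y"
      by (simp only: integral_mult_right_zero Fx_int_eq[OF integrable_nu_measurable[OF f]])
    finally show "complex_of_real (gaussw n y) * Fx_int f y * cnj (chi x y)
        = (\<integral>x'. f x' * (complex_of_real (gaussw n y) * (chi x' y * cnj (chi x y))) \<partial>nu)"
      by (simp add: mult_ac)
  qed simp
  also have "\<dots> = (\<integral>x'. (\<integral>y. f x' * (complex_of_real (gaussw n y) * (chi x' y * cnj (chi x y))) \<partial>nu) \<partial>nu)"
  proof (rule nunu.Fubini_integral_nn)
    have "(\<integral>\<^sup>+y. (\<integral>\<^sup>+x'. ennreal (norm (f x' * (complex_of_real (gaussw n y) * (chi x' y * cnj (chi x y))))) \<partial>nu) \<partial>nu)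
        = (\<integral>\<^sup>+x. ennreal (norm (f x)) \<partial>nu) * (\<integral>\<^sup>+y. ennreal (norm (gaussw n y)) \<partial>nu)"
      by (simp add: norm_mult ennreal_mult' nn_integral_cmult nn_integral_multc)
    also have "\<dots> < \<infinity>"
      using f integrable_gaussw[OF n] by (auto simp: integrable_iff_bounded ennreal_mult_less_top)
    finally show "(\<integral>\<^sup>+y. (\<integral>\<^sup>+x'. ennreal (norm (f x' * (complex_of_real (gaussw n y) * (chi x' y * cnj (chi x y))))) \<partial>nu) \<partial>nu) < \<infinity>" .
  qed measurable
  also have "\<dots> = (\<integral>x'. f x' * complex_of_real (gaussk n (x' / x)) \<partial>nu)"
  proof (rule integral_cong_AE)
    show "AE x' in nu. (\<integral>y. f x' * (complex_of_real (gaussw n y) * (chi x' y * cnj (chi x y))) \<partial>nu)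
        = f x' * complex_of_real (gaussk n (x' / x))"
      using AE_nu_nonzero
      by eventually_elim (use x in \<open>simp add: gaussw_transform[OF n] flip: chi_divide\<close>)
  qed measurable
  also have "\<dots> = (\<integral>r. f (x * r) * complex_of_real (gaussk n (x * r / x)) \<partial>nu)"
    using x by (rule integral_nu_mult[symmetric, of _ "\<lambda>x'. f x' * complex_of_real (gaussk n (x' / x))"]) measurable
  also have "\<dots> = gconv n f x"
    using x by (simp add: gconv_def mult.commute)
  finally show ?thesis .
qed

text \<open>Conjugate the previous formula; \<open>gaussw\<close> and \<open>gaussk\<close> are
  real.\<close>

lemma Fx_int_gaussw_Fx_adj:
  assumes n: "n > 0" and f: "integrable nu f" and x: "x \<noteq> 0"
  shows "Fx_int (\<lambda>y. complex_of_real (gaussw n y) * Fx_adj f y) x = gconv n f x"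
proof -
  note [measurable] = integrable_nu_measurable[OF f]
  have f': "integrable nu (\<lambda>x. cnj (f x))" using f by simp
  have "Fx_adj (\<lambda>y. complex_of_real (gaussw n y) * Fx_int (\<lambda>x. cnj (f x)) y) x = gconv n (\<lambda>x. cnj (f x)) x"
    by (rule Fx_adj_gaussw_Fx_int[OF n f' x])
  hence "cnj (Fx_adj (\<lambda>y. complex_of_real (gaussw n y) * Fx_int (\<lambda>x. cnj (f x)) y) x)
      = cnj (gconv n (\<lambda>x. cnj (f x)) x)" by simp
  moreover have "cnj (gconv n (\<lambda>x. cnj (f x)) x) = gconv n f x"
    by (simp add: gconv_def flip: Bochner_Integration.integral_cnj)
  ultimately show ?thesis
    by (simp add: Fx_adj_eq_cnj)
qed

text \<open>Fatou's lemma under a uniform bound.\<close>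

lemma nn_integral_le_of_tendsto:
  fixes f :: "nat \<Rightarrow> 'a \<Rightarrow> ennreal"
  assumes [measurable]: "\<And>n. f n \<in> borel_measurable M"
    and lim: "AE x in M. (\<lambda>n. f n x) \<longlonglongrightarrow> g x"
    and bound: "\<And>n. (\<integral>\<^sup>+x. f n x \<partial>M) \<le> C"
  shows "(\<integral>\<^sup>+x. g x \<partial>M) \<le> C"
proof -
  have "(\<integral>\<^sup>+x. g x \<partial>M) \<le> (\<integral>\<^sup>+x. liminf (\<lambda>n. f n x) \<partial>M)"
    using lim by (intro nn_integral_mono_AE) (auto elim!: eventually_mono dest!: lim_imp_Liminf[rotated])
  also have "\<dots> \<le> liminf (\<lambda>n. \<integral>\<^sup>+x. f n x \<partial>M)"
    by (rule nn_integral_liminf) measurable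
  also have "\<dots> \<le> liminf (\<lambda>n. C)"
    by (intro Liminf_mono always_eventually allI bound)
  finally show ?thesis by (simp add: Liminf_const)
qed

lemma gaussw_tendsto_1: "(\<lambda>n. gaussw (real (Suc n)) y) \<longlonglongrightarrow> 1"
proof -
  have "(\<lambda>n. exp (- (ln \<bar>y\<bar>)\<^sup>2 / 2 * (inverse (real (Suc n)))\<^sup>2)) \<longlonglongrightarrow> exp (- (ln \<bar>y\<bar>)\<^sup>2 / 2 * 0\<^sup>2)"
    by (intro tendsto_intros LIMSEQ_inverse_real_of_nat)
  thus ?thesis by (simp add: gaussw_def field_simps)
qed

lemma gaussw_le_1: "gaussw n y \<le> 1"
  by (simp add: gaussw_def)

lemma gaussw_nonneg [simp]: "gaussw n y \<ge> 0"
  by (simp add: gaussw_def)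

text \<open>Expand the square of a - c b.\<close>

lemma mult_le_weighted_squares:
  fixes a b c :: real
  assumes "c > 0"
  shows "a * b \<le> 1 / (2 * c) * a\<^sup>2 + c / 2 * b\<^sup>2"
proof -
  have "2 * c * (1 / (2 * c) * a\<^sup>2 + c / 2 * b\<^sup>2 - a * b) = (a - c * b)\<^sup>2"
    using assms by (simp add: power2_eq_square algebra_simps)
  also have "\<dots> \<ge> 0" by simp
  finally show ?thesis using assms by (simp add: zero_le_mult_iff)
qed

text \<open>With G the Gaussian weight, the integral of G |F f|^2 is the pairing of G F f with F f.
  Moving F to the other side by the adjoint gives the pairing of \<open>gconv n f\<close> with
  \<open>f\<close>, at most \<open>4 * pi * nrm2 f\<close> since averaging has norm at most
  \<open>4 * pi\<close>. The bound is uniform in \<open>n\<close>, so Fatou removes G.\<close>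

lemma nrm2_Fx_int_le:
  assumes f: "integrable nu f"
  shows "nrm2 (Fx_int f) \<le> ennreal (4 * pi) * nrm2 f"
  unfolding nrm2_def[of "Fx_int f"]
proof (rule nn_integral_le_of_tendsto)
  note [measurable] = integrable_nu_measurable[OF f]
  define G where "G n y = gaussw (real (Suc n)) y" for n y
  have [measurable]: "G n \<in> borel_measurable borel" for n unfolding G_def by measurable
  show "(\<lambda>y. ennreal (G n y * (cmod (Fx_int f y))\<^sup>2)) \<in> borel_measurable nu" for n
    by measurable
  show "AE y in nu. (\<lambda>n. ennreal (G n y * (cmod (Fx_int f y))\<^sup>2)) \<longlonglongrightarrow> ennreal ((cmod (Fx_int f y))\<^sup>2)"
  proof (rule AE_I2)
    fix y
    have "(\<lambda>n. G n y * (cmod (Fx_int f y))\<^sup>2) \<longlonglongrightarrow> 1 * (cmod (Fx_int f y))\<^sup>2"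
      unfolding G_def by (intro tendsto_intros gaussw_tendsto_1)
    thus "(\<lambda>n. ennreal (G n y * (cmod (Fx_int f y))\<^sup>2)) \<longlonglongrightarrow> ennreal ((cmod (Fx_int f y))\<^sup>2)"
      by (intro tendsto_ennrealI) simp
  qed
  show "(\<integral>\<^sup>+y. ennreal (G n y * (cmod (Fx_int f y))\<^sup>2) \<partial>nu) \<le> ennreal (4 * pi) * nrm2 f" for n
  proof -
    let ?n = "real (Suc n)"
    define B where "B = (\<integral>x. norm (f x) \<partial>nu)"
    have B: "norm (Fx_int f y) \<le> B" for y
      unfolding B_def by (rule norm_Fx_int_le[OF f])
    have B2: "norm ((cmod (Fx_int f y))\<^sup>2) \<le> B\<^sup>2" for y
      using B[of y] by (simp add: power_mono)
    have i1: "integrable nu (\<lambda>y. complex_of_real (G n y) * Fx_int f y)"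
      unfolding G_def by (rule integrable_gaussw_mult[OF _ _ B]) auto
    have i2: "integrable nu (\<lambda>y. complex_of_real (G n y) * complex_of_real ((cmod (Fx_int f y))\<^sup>2))"
      unfolding G_def using B2 by (intro integrable_gaussw_mult[where B = "B\<^sup>2"]) (auto simp: norm_power)
    hence i3: "integrable nu (\<lambda>y. G n y * (cmod (Fx_int f y))\<^sup>2)"
      by (simp only: of_real_mult[symmetric] complex_of_real_integrable_eq)
    have "complex_of_real (\<integral>y. G n y * (cmod (Fx_int f y))\<^sup>2 \<partial>nu)
        = (\<integral>y. (complex_of_real (G n y) * Fx_int f y) * cnj (Fx_int f y) \<partial>nu)"
      by (subst integral_complex_of_real[symmetric])
        (intro Bochner_Integration.integral_cong, auto simp: complex_norm_square mult.assoc simp del: of_real_power)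
    also have "\<dots> = (\<integral>x. Fx_adj (\<lambda>y. complex_of_real (G n y) * Fx_int f y) x * cnj (f x) \<partial>nu)"
      by (rule adjoint_Fx_int[OF f i1])
    also have "\<dots> = (\<integral>x. gconv ?n f x * cnj (f x) \<partial>nu)"
    proof (rule integral_cong_AE)
      show "AE x in nu. Fx_adj (\<lambda>y. complex_of_real (G n y) * Fx_int f y) x * cnj (f x) = gconv ?n f x * cnj (f x)"
        using AE_nu_nonzero
        by eventually_elim (simp add: G_def Fx_adj_gaussw_Fx_int[OF _ f])
    qed measurable
    finally have eq: "complex_of_real (\<integral>y. G n y * (cmod (Fx_int f y))\<^sup>2 \<partial>nu) = (\<integral>x. gconv ?n f x * cnj (f x) \<partial>nu)" .
    have nonneg: "(\<integral>y. G n y * (cmod (Fx_int f y))\<^sup>2 \<partial>nu) \<ge> 0"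
      by (intro Bochner_Integration.integral_nonneg) (simp add: G_def)
    have "(\<integral>\<^sup>+y. ennreal (G n y * (cmod (Fx_int f y))\<^sup>2) \<partial>nu) = ennreal (\<integral>y. G n y * (cmod (Fx_int f y))\<^sup>2 \<partial>nu)"
      by (rule nn_integral_eq_integral[OF i3]) (simp add: G_def)
    also have "\<dots> = ennreal (norm (complex_of_real (\<integral>y. G n y * (cmod (Fx_int f y))\<^sup>2 \<partial>nu)))"
      using nonneg by simp
    also have "\<dots> \<le> (\<integral>\<^sup>+x. ennreal (norm (gconv ?n f x * cnj (f x))) \<partial>nu)"
      unfolding eq by (rule norm_integral_le_nn_integral)
    \<comment> \<open>weighted AM-GM, the weight making both halves equal to \<open>2 * pi * nrm2 f\<close>\<close>
    also have "\<dots> \<le> (\<integral>\<^sup>+x. ennreal (1 / (8 * pi)) * ennreal ((cmod (gconv ?n f x))\<^sup>2) + ennreal (2 * pi) * ennreal ((cmod (f x))\<^sup>2) \<partial>nu)"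
    proof (rule nn_integral_mono)
      fix x
      have "norm (gconv ?n f x * cnj (f x)) \<le> 1 / (8 * pi) * (cmod (gconv ?n f x))\<^sup>2 + 2 * pi * (cmod (f x))\<^sup>2"
        using mult_le_weighted_squares[of "4 * pi" "cmod (gconv ?n f x)" "cmod (f x)"] by (simp add: norm_mult)
      hence "ennreal (norm (gconv ?n f x * cnj (f x))) \<le> ennreal (1 / (8 * pi) * (cmod (gconv ?n f x))\<^sup>2 + 2 * pi * (cmod (f x))\<^sup>2)"
        by (rule ennreal_leI)
      also have "\<dots> = ennreal (1 / (8 * pi)) * ennreal ((cmod (gconv ?n f x))\<^sup>2) + ennreal (2 * pi) * ennreal ((cmod (f x))\<^sup>2)"
        by (subst ennreal_plus) (auto simp: ennreal_mult'[symmetric] ennreal_mult[symmetric])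
      finally show "ennreal (norm (gconv ?n f x * cnj (f x))) \<le> \<dots>" .
    qed
    also have "\<dots> = ennreal (1 / (8 * pi)) * nrm2 (gconv ?n f) + ennreal (2 * pi) * nrm2 f"
      unfolding nrm2_def by (subst nn_integral_add) (auto simp: nn_integral_cmult)
    also have "\<dots> \<le> ennreal (1 / (8 * pi)) * (ennreal ((4 * pi)\<^sup>2) * nrm2 f) + ennreal (2 * pi) * nrm2 f"
      by (intro add_mono mult_left_mono nrm2_gconv_le) auto
    also have "ennreal (1 / (8 * pi)) * (ennreal ((4 * pi)\<^sup>2) * nrm2 f) = ennreal (1 / (8 * pi) * (4 * pi)\<^sup>2) * nrm2 f"
      by (subst ennreal_mult) (auto simp: mult.assoc)
    also have "1 / (8 * pi) * (4 * pi)\<^sup>2 = 2 * pi"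
      by (simp add: power2_eq_square)
    also have "ennreal (2 * pi) * nrm2 f + ennreal (2 * pi) * nrm2 f = ennreal (4 * pi) * nrm2 f"
      by (subst distrib_right[symmetric], subst ennreal_plus[symmetric]) auto
    finally show ?thesis .
  qed
qed

lemma nrm2_Fx_adj_le:
  assumes f: "integrable nu f"
  shows "nrm2 (Fx_adj f) \<le> ennreal (4 * pi) * nrm2 f"
proof -
  have "nrm2 (Fx_adj f) = nrm2 (Fx_int (\<lambda>y. cnj (f y)))"
    by (rule nrm2_cong_AE) (simp add: Fx_adj_eq_cnj integrable_nu_measurable[OF f])
  also have "\<dots> \<le> ennreal (4 * pi) * nrm2 (\<lambda>y. cnj (f y))"
    by (rule nrm2_Fx_int_le) (use f in simp)
  also have "nrm2 (\<lambda>y. cnj (f y)) = nrm2 f"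
    by (rule nrm2_cong_AE) simp
  finally show ?thesis .
qed

section \<open>Extension by continuity\<close>

lemma memL2_winv_iff: "memL2 winv u \<longleftrightarrow> u \<in> borel_measurable borel \<and> nrm2 u < \<infinity>"
  unfolding memL2_def nrm2_def
  by (auto simp: nn_integral_nu ennreal_mult')

lemma memL1_winv_iff: "memL1 winv u \<longleftrightarrow> integrable nu u"
  unfolding memL1_def integrable_iff_bounded
  by (auto simp: nn_integral_nu ennreal_mult')

lemma L2conv_winv_iff:
  assumes [measurable]: "\<And>n. U n \<in> borel_measurable borel" "u \<in> borel_measurable borel"
  shows "L2conv winv U u \<longleftrightarrow> (\<lambda>n. nrm2 (\<lambda>x. U n x - u x)) \<longlonglongrightarrow> 0"
  unfolding L2conv_def nrm2_def
  by (simp add: nn_integral_nu ennreal_mult')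

lemma tendsto_0_ennrealI:
  fixes f :: "'a \<Rightarrow> ennreal"
  assumes "\<And>e::real. e > 0 \<Longrightarrow> eventually (\<lambda>n. f n \<le> ennreal e) F"
  shows "(f \<longlongrightarrow> 0) F"
proof (rule order_tendstoI)
  fix a :: ennreal assume "0 < a"
  obtain e :: real where e: "e > 0" "ennreal e < a"
  proof (cases a)
    case (real r)
    with \<open>0 < a\<close> show ?thesis by (intro that[of "r / 2"]) (auto simp: ennreal_less_iff)
  next
    case top
    thus ?thesis by (intro that[of 1]) auto
  qed
  show "eventually (\<lambda>n. f n < a) F"
    using assms[OF e(1)] by eventually_elim (use e(2) in auto)
qed simp

lemma tendsto_0_ennrealD:
  fixes f :: "'a \<Rightarrow> ennreal"
  assumes "(f \<longlongrightarrow> 0) F" "e > (0::real)"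
  shows "eventually (\<lambda>n. f n < ennreal e) F"
  using assms by (intro order_tendstoD) auto

lemma ennreal_eq_0_if_le_mult:
  fixes x :: ennreal
  assumes "C > 0" and "\<And>e::real. e > 0 \<Longrightarrow> x \<le> ennreal (C * e)"
  shows "x = 0"
proof -
  have "x \<le> 0"
  proof (rule ennreal_le_epsilon)
    fix e :: real assume "e > 0"
    thus "x \<le> 0 + ennreal e" using assms(2)[of "e / C"] assms(1) by simp
  qed
  thus ?thesis by simp
qed

lemma nrm2_triangle_less:
  assumes [measurable]: "u \<in> borel_measurable borel" "v \<in> borel_measurable borel" "w \<in> borel_measurable borel"
    and "nrm2 (\<lambda>x. u x - v x) \<le> ennreal a" "nrm2 (\<lambda>x. v x - w x) \<le> ennreal b" "a \<ge> 0" "b \<ge> 0"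
  shows "nrm2 (\<lambda>x. u x - w x) \<le> ennreal (2 * a + 2 * b)"
proof -
  have "nrm2 (\<lambda>x. u x - w x) \<le> 2 * nrm2 (\<lambda>x. u x - v x) + 2 * nrm2 (\<lambda>x. v x - w x)"
    by (rule nrm2_triangle) measurable
  also have "\<dots> \<le> 2 * ennreal a + 2 * ennreal b"
    using assms by (intro add_mono mult_left_mono) auto
  also have "\<dots> = ennreal (2 * a + 2 * b)"
    using assms(6,7) by (simp add: ennreal_mult')
  finally show ?thesis .
qed

text \<open>This replaces approximating sequences by a single \<open>f\<close> that is close in both
  coordinates at once: the relation is the closure of the graph of \<open>Fx_int\<close> on L1 and
  L2. Taking e = 1 / (n + 1) recovers a sequence.\<close>

lemma Fx_rel_iff:
  "Fx_rel u v \<longleftrightarrow> u \<in> borel_measurable borel \<and> nrm2 u < \<infinity> \<and> v \<in> borel_measurable borel \<and> nrm2 v < \<infinity> \<and>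
     (\<forall>e>0. \<exists>f. integrable nu f \<and> nrm2 f < \<infinity> \<and> nrm2 (\<lambda>x. f x - u x) \<le> ennreal e \<and>
        nrm2 (\<lambda>y. Fx_int f y - v y) \<le> ennreal e)"
  (is "_ \<longleftrightarrow> ?R")
proof
  assume F: "Fx_rel u v"
  then obtain U where [measurable]: "u \<in> borel_measurable borel" "v \<in> borel_measurable borel"
    and fin: "nrm2 u < \<infinity>" "nrm2 v < \<infinity>"
    and U: "\<And>n. integrable nu (U n)" "\<And>n. nrm2 (U n) < \<infinity>"
    and conv: "L2conv winv U u" "L2conv winv (\<lambda>n. Fx_int (U n)) v"
    by (auto simp: Fx_rel_def memL1_winv_iff memL2_winv_iff)
  have [measurable]: "U n \<in> borel_measurable borel" for n
    by (rule integrable_nu_measurable[OF U(1)])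
  have "\<exists>f. integrable nu f \<and> nrm2 f < \<infinity> \<and> nrm2 (\<lambda>x. f x - u x) \<le> ennreal e \<and>
        nrm2 (\<lambda>y. Fx_int f y - v y) \<le> ennreal e" if "e > 0" for e
  proof -
    have "eventually (\<lambda>n. nrm2 (\<lambda>x. U n x - u x) < ennreal e) sequentially"
      using conv(1) that by (intro tendsto_0_ennrealD) (simp_all add: L2conv_winv_iff)
    moreover have "eventually (\<lambda>n. nrm2 (\<lambda>x. Fx_int (U n) x - v x) < ennreal e) sequentially"
      using conv(2) that by (intro tendsto_0_ennrealD) (simp_all add: L2conv_winv_iff)
    ultimately have "eventually (\<lambda>n. nrm2 (\<lambda>x. U n x - u x) < ennreal e \<and> nrm2 (\<lambda>x. Fx_int (U n) x - v x) < ennreal e) sequentially"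
      by (rule eventually_conj)
    then obtain n where "nrm2 (\<lambda>x. U n x - u x) < ennreal e" "nrm2 (\<lambda>x. Fx_int (U n) x - v x) < ennreal e"
      by (auto simp: eventually_sequentially)
    thus ?thesis using U by (intro exI[of _ "U n"]) auto
  qed
  thus ?R using fin by auto
next
  assume R: ?R
  hence [measurable]: "u \<in> borel_measurable borel" "v \<in> borel_measurable borel" by auto
  have "\<forall>n. \<exists>f. integrable nu f \<and> nrm2 f < \<infinity> \<and> nrm2 (\<lambda>x. f x - u x) \<le> ennreal (inverse (real (Suc n))) \<and>
        nrm2 (\<lambda>y. Fx_int f y - v y) \<le> ennreal (inverse (real (Suc n)))"
    using R by simp
  then obtain U where U: "\<And>n. integrable nu (U n)" "\<And>n. nrm2 (U n) < \<infinity>"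
    "\<And>n. nrm2 (\<lambda>x. U n x - u x) \<le> ennreal (inverse (real (Suc n)))"
    "\<And>n. nrm2 (\<lambda>x. Fx_int (U n) x - v x) \<le> ennreal (inverse (real (Suc n)))"
    by metis
  have [measurable]: "U n \<in> borel_measurable borel" for n
    by (rule integrable_nu_measurable[OF U(1)])
  have lim0: "(\<lambda>n. ennreal (inverse (real (Suc n)))) \<longlonglongrightarrow> 0"
    using tendsto_ennrealI[OF LIMSEQ_inverse_real_of_nat] by simp
  have "(\<lambda>n. nrm2 (\<lambda>x. U n x - u x)) \<longlonglongrightarrow> 0" "(\<lambda>n. nrm2 (\<lambda>x. Fx_int (U n) x - v x)) \<longlonglongrightarrow> 0"
    by (rule tendsto_sandwich[OF _ _ tendsto_const lim0]; use U in simp)+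
  hence "L2conv winv U u" "L2conv winv (\<lambda>n. Fx_int (U n)) v"
    by (simp_all add: L2conv_winv_iff)
  thus "Fx_rel u v"
    using R U(1,2) unfolding Fx_rel_def memL1_winv_iff memL2_winv_iff
    by (intro conjI exI[of _ U]) auto
qed

text \<open>Two approximants of the same \<open>u\<close> are close to each other, and the L2 bound
  makes their transforms close as well.\<close>

lemma Fx_rel_unique:
  assumes 1: "Fx_rel u v" and 2: "Fx_rel u v'"
  shows "AE y in nu. v y = v' y"
proof -
  have [measurable]: "u \<in> borel_measurable borel" "v \<in> borel_measurable borel" "v' \<in> borel_measurable borel"
    using 1 2 by (auto simp: Fx_rel_iff)
  \<comment> \<open>The approximants differ by at most 4 e, so their transforms differ by at most 16
    pi e. The triangle inequality, used twice with its factors 2, gives 2 e + 2 (32 pi e + 2 e) = (6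
    + 64 pi) e.\<close>
  have "nrm2 (\<lambda>y. v y - v' y) \<le> ennreal ((6 + 64 * pi) * e)" if e: "e > 0" for e
  proof -
    obtain f where f: "integrable nu f" "nrm2 (\<lambda>x. f x - u x) \<le> ennreal e" "nrm2 (\<lambda>y. Fx_int f y - v y) \<le> ennreal e"
      using 1 e by (auto simp: Fx_rel_iff)
    obtain f' where f': "integrable nu f'" "nrm2 (\<lambda>x. f' x - u x) \<le> ennreal e" "nrm2 (\<lambda>y. Fx_int f' y - v' y) \<le> ennreal e"
      using 2 e by (auto simp: Fx_rel_iff)
    have [measurable]: "f \<in> borel_measurable borel" "f' \<in> borel_measurable borel"
      using f f' by (auto intro: integrable_nu_measurable)
    have "nrm2 (\<lambda>x. f x - f' x) \<le> ennreal (2 * e + 2 * e)"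
      using f f' e by (intro nrm2_triangle_less[of f u f']) (auto simp: nrm2_commute[of u])
    hence "ennreal (4 * pi) * nrm2 (\<lambda>x. f x - f' x) \<le> ennreal (4 * pi) * ennreal (2 * e + 2 * e)"
      by (rule mult_left_mono) simp
    also have "\<dots> = ennreal (4 * pi * (2 * e + 2 * e))"
      using e by (intro ennreal_mult[symmetric]) auto
    finally have "nrm2 (Fx_int (\<lambda>x. f x - f' x)) \<le> ennreal (4 * pi * (2 * e + 2 * e))"
      using nrm2_Fx_int_le[OF Bochner_Integration.integrable_diff[OF f(1) f'(1)]] by (rule order_trans[rotated])
    hence "nrm2 (\<lambda>y. Fx_int f y - Fx_int f' y) \<le> ennreal (4 * pi * (4 * e))"
      unfolding Fx_int_diff[OF f(1) f'(1), abs_def] by simp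
    hence "nrm2 (\<lambda>y. Fx_int f y - v' y) \<le> ennreal (2 * (4 * pi * (4 * e)) + 2 * e)"
      using f' e by (intro nrm2_triangle_less[of _ "Fx_int f'"]) auto
    hence "nrm2 (\<lambda>y. v y - v' y) \<le> ennreal (2 * e + 2 * (2 * (4 * pi * (4 * e)) + 2 * e))"
    proof (intro nrm2_triangle_less[of v "Fx_int f" v'])
      show "nrm2 (\<lambda>y. v y - Fx_int f y) \<le> ennreal e"
        using f(3) nrm2_commute[of v "Fx_int f"] by simp
    qed (use e in auto)
    thus ?thesis by (simp add: algebra_simps)
  qed
  moreover have "0 < 6 + 64 * pi" using pi_gt_zero by linarith
  ultimately have "nrm2 (\<lambda>y. v y - v' y) = 0"
    by (intro ennreal_eq_0_if_le_mult)
  thus ?thesis by (intro AE_eq_if_nrm2_eq_0) auto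
qed

text \<open>The relation is already a closure: choose \<open>n\<close> with \<open>U n\<close> and
  \<open>V n\<close> near the limits, then \<open>f\<close> near that pair.\<close>

lemma Fx_rel_closed:
  assumes rel: "\<And>n. Fx_rel (U n) (V n)"
    and [measurable]: "u \<in> borel_measurable borel" "v \<in> borel_measurable borel"
    and fin: "nrm2 u < \<infinity>" "nrm2 v < \<infinity>"
    and U: "(\<lambda>n. nrm2 (\<lambda>x. U n x - u x)) \<longlonglongrightarrow> 0" and V: "(\<lambda>n. nrm2 (\<lambda>x. V n x - v x)) \<longlonglongrightarrow> 0"
  shows "Fx_rel u v"
  unfolding Fx_rel_iff
proof (intro conjI allI impI)
  have [measurable]: "U n \<in> borel_measurable borel" "V n \<in> borel_measurable borel" for n
    using rel[of n] by (auto simp: Fx_rel_iff)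
  fix e :: real assume "e > 0"
  \<comment> \<open>The doubled triangle inequality gives 2 (e / 4) + 2 (e / 4) = e.\<close>
  hence e: "e / 4 > 0" by simp
  have "eventually (\<lambda>n. nrm2 (\<lambda>x. U n x - u x) < ennreal (e / 4) \<and> nrm2 (\<lambda>x. V n x - v x) < ennreal (e / 4)) sequentially"
    by (intro eventually_conj tendsto_0_ennrealD U V e)
  then obtain n where n: "nrm2 (\<lambda>x. U n x - u x) < ennreal (e / 4)" "nrm2 (\<lambda>x. V n x - v x) < ennreal (e / 4)"
    by (auto simp: eventually_sequentially)
  obtain f where f: "integrable nu f" "nrm2 f < \<infinity>" "nrm2 (\<lambda>x. f x - U n x) \<le> ennreal (e / 4)"
      "nrm2 (\<lambda>y. Fx_int f y - V n y) \<le> ennreal (e / 4)"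
    using rel[of n, unfolded Fx_rel_iff] e by blast
  have [measurable]: "f \<in> borel_measurable borel" by (rule integrable_nu_measurable[OF f(1)])
  have "nrm2 (\<lambda>x. f x - u x) \<le> ennreal (2 * (e / 4) + 2 * (e / 4))"
    using f n e by (intro nrm2_triangle_less[of f "U n"]) auto
  moreover have "nrm2 (\<lambda>x. Fx_int f x - v x) \<le> ennreal (2 * (e / 4) + 2 * (e / 4))"
    using f n e by (intro nrm2_triangle_less[of _ "V n"]) auto
  ultimately show "\<exists>f. integrable nu f \<and> nrm2 f < \<infinity> \<and> nrm2 (\<lambda>x. f x - u x) \<le> ennreal e \<and>
        nrm2 (\<lambda>y. Fx_int f y - v y) \<le> ennreal e"
    using f by (intro exI[of _ f]) simp
qed (use fin in auto)

text \<open>Apply closedness to constant sequences. It is used to ignore the value at 0.\<close>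

lemma Fx_rel_cong:
  assumes rel: "Fx_rel u v" and [measurable]: "u' \<in> borel_measurable borel" and eq: "AE x in nu. u' x = u x"
  shows "Fx_rel u' v"
proof (rule Fx_rel_closed)
  have [measurable]: "u \<in> borel_measurable borel" "v \<in> borel_measurable borel"
    using rel by (auto simp: Fx_rel_iff)
  show "nrm2 u' < \<infinity>"
  proof -
    have "nrm2 u' = nrm2 u" using eq by (intro nrm2_cong_AE) auto
    thus ?thesis using rel by (simp add: Fx_rel_iff)
  qed
  have "nrm2 (\<lambda>x. u x - u' x) = nrm2 (\<lambda>x. 0)"
    using eq by (intro nrm2_cong_AE) auto
  thus "(\<lambda>n. nrm2 (\<lambda>x. u x - u' x)) \<longlonglongrightarrow> 0"
    by (simp add: nrm2_def)
  show "(\<lambda>n. nrm2 (\<lambda>x. v x - v x)) \<longlonglongrightarrow> 0"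
    by (simp add: nrm2_def)
qed (use rel in \<open>auto simp: Fx_rel_iff\<close>)

lemma (in mconv) symbol_measurable [measurable]: "symbol \<in> borel_measurable borel"
  unfolding symbol_def by measurable

text \<open>If \<open>f\<close> approximates the pair \<open>u\<close>, \<open>v\<close>, then
  \<open>conv f\<close> approximates the new pair: both averaging and multiplication by
  \<open>symbol\<close> have L2 norm at most M, and on integrable functions they correspond
  exactly.\<close>

lemma (in mconv) Fx_rel_conv:
  assumes rel: "Fx_rel u v"
  shows "Fx_rel (conv u) (\<lambda>y. symbol y * v y)"
proof -
  define M where "M = enn2real mass"
  have mass: "mass = ennreal M" and M: "M \<ge> 0"
    unfolding M_def using mass_finite by (auto simp: less_top)
  have [measurable]: "u \<in> borel_measurable borel" "v \<in> borel_measurable borel"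
    and fin: "nrm2 u < \<infinity>" "nrm2 v < \<infinity>"
    using rel by (auto simp: Fx_rel_iff)
  have sym: "nrm2 (\<lambda>y. symbol y * w y) \<le> ennreal (M\<^sup>2) * nrm2 w"
    if [measurable]: "w \<in> borel_measurable borel" for w
  proof -
    have "nrm2 (\<lambda>y. symbol y * w y) \<le> nrm2 (\<lambda>y. complex_of_real M * w y)"
      using norm_symbol_le M by (intro nrm2_mono_AE AE_I2) (auto simp: norm_mult M_def intro!: mult_right_mono)
    thus ?thesis using M by (simp add: nrm2_cmult)
  qed
  have cfin: "nrm2 (conv w) < \<infinity>" if "w \<in> borel_measurable borel" "nrm2 w < \<infinity>" for w
    using nrm2_conv_le[OF that(1)] that(2) mass_finite
    by (auto intro!: le_less_trans[OF nrm2_conv_le[OF that(1)]] simp: ennreal_mult_less_top power_less_top_ennreal)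
  show ?thesis
    unfolding Fx_rel_iff
  proof (intro conjI allI impI)
    show "nrm2 (conv u) < \<infinity>" using fin by (intro cfin) auto
    show "nrm2 (\<lambda>y. symbol y * v y) < \<infinity>"
      using fin by (intro le_less_trans[OF sym]) (auto simp: ennreal_mult_less_top)
    fix e :: real assume e: "e > 0"
    \<comment> \<open>The summand 1 keeps the denominator positive when M = 0, and M^2 d is still at
      most \<open>e\<close>.\<close>
    define d where "d = e / (M\<^sup>2 + 1)"
    have M1: "M\<^sup>2 + 1 > 0" by (simp add: add_nonneg_pos)
    have d: "d > 0" "M\<^sup>2 * d \<le> e"
      using e M1 by (auto simp: d_def field_simps)
    obtain f where f: "integrable nu f" "nrm2 f < \<infinity>" "nrm2 (\<lambda>x. f x - u x) \<le> ennreal d"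
      "nrm2 (\<lambda>y. Fx_int f y - v y) \<le> ennreal d"
      using rel d by (auto simp: Fx_rel_iff)
    have [measurable]: "f \<in> borel_measurable borel" by (rule integrable_nu_measurable[OF f(1)])
    have dd: "ennreal (M\<^sup>2) * ennreal d \<le> ennreal e"
      using d by (simp add: ennreal_leI flip: ennreal_mult)
    have "nrm2 (\<lambda>x. conv f x - conv u x) \<le> mass\<^sup>2 * nrm2 (\<lambda>x. f x - u x)"
      by (rule nrm2_conv_diff_le) (use f fin in auto)
    also have "\<dots> \<le> ennreal (M\<^sup>2) * ennreal d"
      using f(3) M by (auto simp: mass ennreal_power intro!: mult_left_mono)
    finally have a: "nrm2 (\<lambda>x. conv f x - conv u x) \<le> ennreal e" using dd by simp
    have "nrm2 (\<lambda>y. Fx_int (conv f) y - symbol y * v y) = nrm2 (\<lambda>y. symbol y * (Fx_int f y - v y))"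
      using f(1) by (simp add: Fx_int_conv right_diff_distrib)
    also have "\<dots> \<le> ennreal (M\<^sup>2) * nrm2 (\<lambda>y. Fx_int f y - v y)"
      by (rule sym) measurable
    also have "\<dots> \<le> ennreal (M\<^sup>2) * ennreal d"
      using f(4) by (intro mult_left_mono) auto
    finally have b: "nrm2 (\<lambda>y. Fx_int (conv f) y - symbol y * v y) \<le> ennreal e" using dd by simp
    show "\<exists>f. integrable nu f \<and> nrm2 f < \<infinity> \<and> nrm2 (\<lambda>x. f x - conv u x) \<le> ennreal e \<and>
        nrm2 (\<lambda>y. Fx_int f y - symbol y * v y) \<le> ennreal e"
      using a b f by (intro exI[of _ "conv f"] conjI integrable_conv cfin) auto
  qed auto
qed

section \<open>Approximate identities\<close>

lemma nn_integral_log_interval: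
  "(\<integral>\<^sup>+x. indicator {x. \<bar>ln \<bar>x\<bar>\<bar> \<le> R} x \<partial>nu) < (\<infinity>::ennreal)"
proof -
  have "(\<integral>\<^sup>+x. indicator {x. \<bar>ln \<bar>x\<bar>\<bar> \<le> R} x \<partial>nu) = 
      (\<integral>\<^sup>+t. indicator {-R..R} t \<partial>lborel) + (\<integral>\<^sup>+t. indicator {-R..R} t \<partial>lborel)"
    by (subst nn_integral_nu_split, measurable)
       (intro arg_cong2[of _ _ _ _ "(+)"] nn_integral_cong; auto simp: indicator_def)
  also have "\<dots> < \<infinity>"
    by (simp add: emeasure_lborel_Icc_eq)
  finally show ?thesis .
qed

text \<open>In the variable \<open>ln \<bar>x\<bar>\<close> on each half line these are the bounded continuous functions of
  bounded support.\<close>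

definition ccont :: "real \<Rightarrow> real \<Rightarrow> (real \<Rightarrow> complex) \<Rightarrow> bool" where
  "ccont B R f \<longleftrightarrow> f \<in> borel_measurable borel \<and> (\<forall>x. norm (f x) \<le> B) \<and>
     (\<forall>x. f x \<noteq> 0 \<longrightarrow> \<bar>ln \<bar>x\<bar>\<bar> \<le> R) \<and> (\<forall>x. x \<noteq> 0 \<longrightarrow> isCont f x)"

lemma ccont_measurable: "ccont B R f \<Longrightarrow> f \<in> borel_measurable borel"
  by (simp add: ccont_def)

lemma ccont_norm_le: "ccont B R f \<Longrightarrow> norm (f x) \<le> B * indicator {x. \<bar>ln \<bar>x\<bar>\<bar> \<le> R} x"
  by (auto simp: ccont_def indicator_def)

lemma ccont_bound_nonneg: "ccont B R f \<Longrightarrow> B \<ge> 0"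
  using norm_ge_zero[of "f 0"] unfolding ccont_def by (metis order_trans)

lemma ccont_integrable:
  assumes f: "ccont B R f"
  shows "integrable nu f"
proof (rule integrableI_bounded)
  have B: "B \<ge> 0" by (rule ccont_bound_nonneg[OF f])
  have "(\<integral>\<^sup>+x. ennreal (norm (f x)) \<partial>nu) \<le> (\<integral>\<^sup>+x. ennreal B * indicator {x. \<bar>ln \<bar>x\<bar>\<bar> \<le> R} x \<partial>nu)"
  proof (rule nn_integral_mono)
    fix x
    show "ennreal (norm (f x)) \<le> ennreal B * indicator {x. \<bar>ln \<bar>x\<bar>\<bar> \<le> R} x"
      using ccont_norm_le[OF f, of x] B by (auto simp: indicator_def intro: ennreal_leI split: if_splits)
  qed
  also have "\<dots> = ennreal B * (\<integral>\<^sup>+x. indicator {x. \<bar>ln \<bar>x\<bar>\<bar> \<le> R} x \<partial>nu)"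
    by (rule nn_integral_cmult) measurable
  also have "\<dots> < \<infinity>"
    using nn_integral_log_interval[of R] by (simp add: ennreal_mult_less_top)
  finally show "(\<integral>\<^sup>+x. ennreal (norm (f x)) \<partial>nu) < \<infinity>" .
qed (use ccont_measurable[OF f] in simp)

lemma nrm2_finite_if_bounded_support:
  assumes f: "\<And>x. norm (f x) \<le> B * indicator {x. \<bar>ln \<bar>x\<bar>\<bar> \<le> R} x"
  shows "nrm2 f < \<infinity>"
proof -
  have "nrm2 f \<le> (\<integral>\<^sup>+x. ennreal (B\<^sup>2) * indicator {x. \<bar>ln \<bar>x\<bar>\<bar> \<le> R} x \<partial>nu)"
    unfolding nrm2_def
  proof (rule nn_integral_mono)
    fix x
    have "(norm (f x))\<^sup>2 \<le> (B * indicator {x. \<bar>ln \<bar>x\<bar>\<bar> \<le> R} x)\<^sup>2"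
      by (intro power_mono f) auto
    thus "ennreal ((norm (f x))\<^sup>2) \<le> ennreal (B\<^sup>2) * indicator {x. \<bar>ln \<bar>x\<bar>\<bar> \<le> R} x"
      by (auto simp: indicator_def intro: ennreal_leI split: if_splits)
  qed
  also have "\<dots> = ennreal (B\<^sup>2) * (\<integral>\<^sup>+x. indicator {x. \<bar>ln \<bar>x\<bar>\<bar> \<le> R} x \<partial>nu)"
    by (rule nn_integral_cmult) measurable
  also have "\<dots> < \<infinity>"
    using nn_integral_log_interval[of R] by (simp add: ennreal_mult_less_top)
  finally show ?thesis .
qed

lemma ccont_nrm2_finite: "ccont B R f \<Longrightarrow> nrm2 f < \<infinity>"
  by (rule nrm2_finite_if_bounded_support[OF ccont_norm_le])

lemma nrm2_dominated_convergence:
  assumes [measurable]: "\<And>n. U n \<in> borel_measurable borel" "u \<in> borel_measurable borel" "w \<in> borel_measurable borel"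
    and bound: "\<And>n. AE x in nu. cmod (U n x - u x) \<le> cmod (w x)" and w: "nrm2 w < \<infinity>"
    and lim: "AE x in nu. (\<lambda>n. U n x) \<longlonglongrightarrow> u x"
  shows "(\<lambda>n. nrm2 (\<lambda>x. U n x - u x)) \<longlonglongrightarrow> 0"
proof -
  have "(\<lambda>n. \<integral>\<^sup>+x. ennreal ((cmod (U n x - u x))\<^sup>2) \<partial>nu) \<longlonglongrightarrow> (\<integral>\<^sup>+x. 0 \<partial>nu)"
  proof (rule nn_integral_dominated_convergence)
    show "AE x in nu. ennreal ((cmod (U n x - u x))\<^sup>2) \<le> ennreal ((cmod (w x))\<^sup>2)" for n
      using bound[of n] by eventually_elim (auto intro!: ennreal_leI power_mono)
    show "(\<integral>\<^sup>+x. ennreal ((cmod (w x))\<^sup>2) \<partial>nu) < \<infinity>"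
      using w by (simp add: nrm2_def)
    show "AE x in nu. (\<lambda>n. ennreal ((cmod (U n x - u x))\<^sup>2)) \<longlonglongrightarrow> 0"
      using lim
    proof eventually_elim
      case (elim x)
      hence "(\<lambda>n. (cmod (U n x - u x))\<^sup>2) \<longlonglongrightarrow> (cmod (u x - u x))\<^sup>2"
        by (intro tendsto_intros)
      from tendsto_ennrealI[OF this] show ?case by simp
    qed
  qed measurable
  thus ?thesis by (simp add: nrm2_def)
qed

text \<open>L2 continuity of dilations at 1, with pointwise convergence from continuity off
  0.\<close>

lemma ccont_dilation_tendsto:
  assumes f: "ccont B R f"
  shows "(\<lambda>n. nrm2 (\<lambda>x. f (exp (z / real (Suc n)) * x) - f x)) \<longlonglongrightarrow> 0"
proof (rule nrm2_dominated_convergence)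
  note [measurable] = ccont_measurable[OF f]
  have B: "B \<ge> 0" by (rule ccont_bound_nonneg[OF f])
  \<comment> \<open>The dilations move ln|x| by at most |z|, so one interval of radius R + |z|
    carries all the functions.\<close>
  let ?I = "indicator {x. \<bar>ln \<bar>x\<bar>\<bar> \<le> R + \<bar>z\<bar>} :: real \<Rightarrow> real"
  show "(\<lambda>x. complex_of_real (2 * B * ?I x)) \<in> borel_measurable borel"
    by measurable
  show "nrm2 (\<lambda>x. complex_of_real (2 * B * ?I x)) < \<infinity>"
    using B by (intro nrm2_finite_if_bounded_support[where B = "2 * B" and R = "R + \<bar>z\<bar>"]) (simp add: norm_mult indicator_def)
  show "AE x in nu. cmod (f (exp (z / real (Suc n)) * x) - f x) \<le> cmod (complex_of_real (2 * B * ?I x))" for n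
    using AE_nu_nonzero
  proof eventually_elim
    fix x :: real assume x: "x \<noteq> 0"
    let ?r = "exp (z / real (Suc n))"
    have zn: "\<bar>z / real (Suc n)\<bar> \<le> \<bar>z\<bar>"
      by (simp add: field_simps mult_right_mono abs_mult)
    have ln: "ln \<bar>?r * x\<bar> = z / real (Suc n) + ln \<bar>x\<bar>"
      using x by (simp add: abs_mult ln_mult)
    have 1: "norm (f (?r * x)) \<le> B * ?I x"
    proof (cases "\<bar>ln \<bar>?r * x\<bar>\<bar> \<le> R")
      case True
      hence "\<bar>ln \<bar>x\<bar>\<bar> \<le> R + \<bar>z\<bar>" using zn unfolding ln by linarith
      thus ?thesis using f by (simp add: ccont_def)
    next
      case False
      hence "f (?r * x) = 0" using f unfolding ccont_def by blast
      thus ?thesis using B by simp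
    qed
    have 2: "norm (f x) \<le> B * ?I x"
    proof (cases "\<bar>ln \<bar>x\<bar>\<bar> \<le> R")
      case True
      hence "\<bar>ln \<bar>x\<bar>\<bar> \<le> R + \<bar>z\<bar>" by linarith
      thus ?thesis using f by (simp add: ccont_def)
    next
      case False
      hence "f x = 0" using f unfolding ccont_def by blast
      thus ?thesis using B by simp
    qed
    have "cmod (f (?r * x) - f x) \<le> 2 * B * ?I x"
      using 1 2 norm_triangle_ineq4[of "f (?r * x)" "f x"] by linarith
    thus "cmod (f (?r * x) - f x) \<le> cmod (complex_of_real (2 * B * ?I x))"
      by (simp only: norm_of_real)
  qed
  show "AE x in nu. (\<lambda>n. f (exp (z / real (Suc n)) * x)) \<longlonglongrightarrow> f x"
    using AE_nu_nonzero
  proof eventually_elim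
    fix x :: real assume "x \<noteq> 0"
    hence "isCont f x" using f by (simp add: ccont_def)
    moreover have "(\<lambda>n. exp (z * inverse (real (Suc n))) * x) \<longlonglongrightarrow> exp (z * 0) * x"
      by (intro tendsto_intros LIMSEQ_inverse_real_of_nat)
    hence "(\<lambda>n. exp (z / real (Suc n)) * x) \<longlonglongrightarrow> x"
      by (simp add: divide_inverse)
    ultimately show "(\<lambda>n. f (exp (z / real (Suc n)) * x)) \<longlonglongrightarrow> f x"
      by (rule isCont_tendsto_compose)
  qed
qed (use ccont_measurable[OF f] in measurable)

text \<open>This is Jensen's inequality for the probability measure \<open>gaussk n\<close> / (4
  pi), obtained from Cauchy-Schwarz: the error is the mean of f(r x) - f(x), so its square is at
  most the mean of the squares. Tonelli and r = exp(z / n) then give the normal density.\<close>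

lemma nrm2_gconv_diff_le:
  assumes n: "n > 0" and [measurable]: "f \<in> borel_measurable borel" and fin: "nrm2 f < \<infinity>"
  shows "nrm2 (\<lambda>x. gconv n f x / (4 * pi) - f x)
     \<le> (\<integral>\<^sup>+z. ennreal (std_normal_density z) * nrm2 (\<lambda>x. f (exp (z / n) * x) - f x) \<partial>lborel)"
proof -
  interpret g: mconv nu "\<lambda>r. complex_of_real (gaussk n r)" "\<lambda>r. r"
    by (rule mconv_gaussk[OF n])
  have gk: "(\<integral>r. complex_of_real (gaussk n r) \<partial>nu) = complex_of_real (4 * pi)"
  proof -
    have "ennreal (\<integral>r. gaussk n r \<partial>nu) = ennreal (4 * pi)"
      using nn_integral_eq_integral[OF integrable_gaussk[OF n]] nn_integral_gaussk[OF n] n by simp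
    hence "(\<integral>r. gaussk n r \<partial>nu) = 4 * pi"
      using n by (subst (asm) ennreal_inj) (auto intro!: Bochner_Integration.integral_nonneg)
    thus ?thesis by simp
  qed
  define D where "D r x = ennreal (gaussk n r) * ennreal ((cmod (f (r * x) - f x))\<^sup>2)" for r x
  have pw: "AE x in nu. ennreal ((cmod (gconv n f x / (4 * pi) - f x))\<^sup>2)
      \<le> ennreal (1 / (4 * pi)) * (\<integral>\<^sup>+r. D r x \<partial>nu)"
    using g.AE_conv_integrable[OF assms(2) fin]
  proof eventually_elim
    case (elim x)
    have sq: "(ennreal (sqrt (gaussk n r)))\<^sup>2 = ennreal (gaussk n r)" for r
      using n by (simp add: ennreal_power)
    have ig: "integrable nu (\<lambda>r. complex_of_real (gaussk n r) * f x)"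
      using integrable_gaussk[OF n] by (intro integrable_mult_left) simp
    have "gconv n f x - 4 * pi * f x = (\<integral>r. complex_of_real (gaussk n r) * (f (r * x) - f x) \<partial>nu)"
      using Bochner_Integration.integral_diff[OF elim ig] gk
      by (simp add: gconv_def right_diff_distrib)
    hence "ennreal (cmod (gconv n f x - 4 * pi * f x))
        \<le> (\<integral>\<^sup>+r. ennreal (norm (complex_of_real (gaussk n r) * (f (r * x) - f x))) \<partial>nu)"
      using norm_integral_le_nn_integral[of nu "\<lambda>r. complex_of_real (gaussk n r) * (f (r * x) - f x)"] by simp
    also have "\<dots> = (\<integral>\<^sup>+r. ennreal (sqrt (gaussk n r)) * (ennreal (sqrt (gaussk n r)) * ennreal (cmod (f (r * x) - f x))) \<partial>nu)"
      using n by (intro nn_integral_cong)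
        (simp add: norm_mult ennreal_mult' mult.assoc[symmetric] power2_eq_square[symmetric] sq)
    finally have "(ennreal (cmod (gconv n f x - 4 * pi * f x)))\<^sup>2
        \<le> (\<integral>\<^sup>+r. ennreal (sqrt (gaussk n r)) * (ennreal (sqrt (gaussk n r)) * ennreal (cmod (f (r * x) - f x))) \<partial>nu)\<^sup>2"
      by (rule power_mono) simp
    also have "\<dots> \<le> (\<integral>\<^sup>+r. (ennreal (sqrt (gaussk n r)))\<^sup>2 \<partial>nu)
        * (\<integral>\<^sup>+r. (ennreal (sqrt (gaussk n r)) * ennreal (cmod (f (r * x) - f x)))\<^sup>2 \<partial>nu)"
      by (rule Cauchy_Schwarz_nn_integral) measurable
    also have "\<dots> = ennreal (4 * pi) * (\<integral>\<^sup>+r. D r x \<partial>nu)"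
      by (simp add: power_mult_distrib sq nn_integral_gaussk[OF n] D_def ennreal_power)
    finally have le: "ennreal ((cmod (gconv n f x - 4 * pi * f x))\<^sup>2) \<le> ennreal (4 * pi) * (\<integral>\<^sup>+r. D r x \<partial>nu)"
      by (simp add: ennreal_power)
    have "gconv n f x / (4 * pi) - f x = (gconv n f x - 4 * pi * f x) / (4 * pi)"
      by (simp add: diff_divide_distrib)
    hence "(cmod (gconv n f x / (4 * pi) - f x))\<^sup>2 = 1 / (4 * pi)\<^sup>2 * (cmod (gconv n f x - 4 * pi * f x))\<^sup>2"
      by (simp add: norm_divide power_divide norm_mult)
    hence "ennreal ((cmod (gconv n f x / (4 * pi) - f x))\<^sup>2)
        = ennreal (1 / (4 * pi)\<^sup>2) * ennreal ((cmod (gconv n f x - 4 * pi * f x))\<^sup>2)"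
      by (simp only:) (rule ennreal_mult; simp)
    also have "\<dots> \<le> ennreal (1 / (4 * pi)\<^sup>2) * (ennreal (4 * pi) * (\<integral>\<^sup>+r. D r x \<partial>nu))"
      by (rule mult_left_mono[OF le]) simp
    also have "\<dots> = ennreal (1 / (4 * pi)\<^sup>2 * (4 * pi)) * (\<integral>\<^sup>+r. D r x \<partial>nu)"
      by (subst ennreal_mult) (auto simp: mult.assoc)
    also have "1 / (4 * pi)\<^sup>2 * (4 * pi) = 1 / (4 * pi)"
      by (simp add: power2_eq_square)
    finally show ?case .
  qed
  have "nrm2 (\<lambda>x. gconv n f x / (4 * pi) - f x) \<le> (\<integral>\<^sup>+x. ennreal (1 / (4 * pi)) * (\<integral>\<^sup>+r. D r x \<partial>nu) \<partial>nu)"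
    unfolding nrm2_def by (rule nn_integral_mono_AE[OF pw])
  also have "\<dots> = ennreal (1 / (4 * pi)) * (\<integral>\<^sup>+x. (\<integral>\<^sup>+r. D r x \<partial>nu) \<partial>nu)"
    unfolding D_def by (rule nn_integral_cmult) measurable
  also have "(\<integral>\<^sup>+x. (\<integral>\<^sup>+r. D r x \<partial>nu) \<partial>nu) = (\<integral>\<^sup>+r. (\<integral>\<^sup>+x. D r x \<partial>nu) \<partial>nu)"
    unfolding D_def by (rule nunu.Fubini') measurable
  also have "\<dots> = (\<integral>\<^sup>+r. ennreal (gaussk n r) * nrm2 (\<lambda>x. f (r * x) - f x) \<partial>nu)"
    unfolding D_def nrm2_def by (intro nn_integral_cong nn_integral_cmult) measurable
  also have "\<dots> = ennreal (4 * pi) * (\<integral>\<^sup>+z. ennreal (std_normal_density z) * nrm2 (\<lambda>x. f (exp (z / n) * x) - f x) \<partial>lborel)"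
    unfolding nrm2_def by (rule nn_integral_gaussk_mult[OF n]) measurable
  also have "ennreal (1 / (4 * pi)) * (ennreal (4 * pi) * (\<integral>\<^sup>+z. ennreal (std_normal_density z) * nrm2 (\<lambda>x. f (exp (z / n) * x) - f x) \<partial>lborel))
     = (\<integral>\<^sup>+z. ennreal (std_normal_density z) * nrm2 (\<lambda>x. f (exp (z / n) * x) - f x) \<partial>lborel)"
    by (subst mult.assoc[symmetric], subst ennreal_mult[symmetric]) auto
  finally show ?thesis .
qed

lemma gconv_tendsto:
  assumes f: "ccont B R f"
  shows "(\<lambda>n. nrm2 (\<lambda>x. gconv (real (Suc n)) f x / (4 * pi) - f x)) \<longlonglongrightarrow> 0"
proof (rule tendsto_sandwich[OF _ _ tendsto_const])
  note [measurable] = ccont_measurable[OF f]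
  \<comment> \<open>By invariance of \<open>nu\<close>, \<open>H\<close> is at most
    \<open>4 * nrm2 f\<close> for every positive dilation. As the normal weight is free of
    \<open>n\<close>, this gives an integrable majorant in \<open>z\<close>.\<close>
  define H where "H r = nrm2 (\<lambda>x. f (r * x) - f x)" for r
  have [measurable]: "H \<in> borel_measurable borel"
    unfolding H_def nrm2_def by measurable
  have H_le: "H r \<le> 4 * nrm2 f" if "r > 0" for r
  proof -
    have "H r \<le> 2 * nrm2 (\<lambda>x. f (r * x) - 0) + 2 * nrm2 (\<lambda>x. 0 - f x)"
      unfolding H_def by (rule nrm2_triangle) measurable
    also have "nrm2 (\<lambda>x. f (r * x) - 0) = nrm2 f"
      using nn_integral_nu_mult[of r "\<lambda>x. ennreal ((cmod (f x))\<^sup>2)"] that by (simp add: nrm2_def)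
    also have "nrm2 (\<lambda>x. 0 - f x) = nrm2 f"
      by (rule nrm2_cong_AE) simp
    also have "2 * nrm2 f + 2 * nrm2 f = 4 * nrm2 f"
      by (simp add: distrib_right[symmetric])
    finally show ?thesis .
  qed
  show "eventually (\<lambda>n. nrm2 (\<lambda>x. gconv (real (Suc n)) f x / (4 * pi) - f x)
     \<le> (\<integral>\<^sup>+z. ennreal (std_normal_density z) * H (exp (z / real (Suc n))) \<partial>lborel)) sequentially"
    unfolding H_def using ccont_nrm2_finite[OF f]
    by (intro always_eventually allI nrm2_gconv_diff_le) auto
  have "(\<lambda>n. \<integral>\<^sup>+z. ennreal (std_normal_density z) * H (exp (z / real (Suc n))) \<partial>lborel) \<longlonglongrightarrow> (\<integral>\<^sup>+z. 0 \<partial>(lborel :: real measure))"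
  proof (rule nn_integral_dominated_convergence)
    show "AE z in lborel. ennreal (std_normal_density z) * H (exp (z / real (Suc n))) \<le> ennreal (std_normal_density z) * (4 * nrm2 f)" for n
      by (intro AE_I2 mult_left_mono H_le) auto
    have "(\<integral>\<^sup>+z. ennreal (std_normal_density z) \<partial>lborel) = 1"
      by (subst nn_integral_eq_integral) auto
    hence "(\<integral>\<^sup>+z. ennreal (std_normal_density z) * (4 * nrm2 f) \<partial>lborel) = 4 * nrm2 f"
      by (simp add: nn_integral_multc)
    thus "(\<integral>\<^sup>+z. ennreal (std_normal_density z) * (4 * nrm2 f) \<partial>lborel) < \<infinity>"
      using ccont_nrm2_finite[OF f] by (simp add: ennreal_mult_less_top)
    show "AE z in lborel. (\<lambda>n. ennreal (std_normal_density z) * H (exp (z / real (Suc n)))) \<longlonglongrightarrow> 0"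
    proof (rule AE_I2)
      fix z :: real
      have "(\<lambda>n. ennreal (std_normal_density z) * H (exp (z / real (Suc n)))) \<longlonglongrightarrow> ennreal (std_normal_density z) * 0"
        using ccont_dilation_tendsto[OF f, of z] unfolding H_def
        by (intro ennreal_tendsto_cmult) auto
      thus "(\<lambda>n. ennreal (std_normal_density z) * H (exp (z / real (Suc n)))) \<longlonglongrightarrow> 0" by simp
    qed
  qed measurable
  thus "(\<lambda>n. \<integral>\<^sup>+z. ennreal (std_normal_density z) * H (exp (z / real (Suc n))) \<partial>lborel) \<longlonglongrightarrow> 0"
    by simp
qed simp

text \<open>Inversion on the dense class. \<open>u = Fx_adj f / (4 * pi)\<close> is bounded and in
  L2, but need not be integrable, so the approximants are \<open>gaussw * u\<close>. Their
  transforms are \<open>gconv f / (4 * pi)\<close>, which tend to \<open>f\<close>.\<close>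

lemma Fx_rel_Fx_adj:
  assumes f: "ccont B R f"
  shows "Fx_rel (\<lambda>x. Fx_adj f x / (4 * pi)) f"
proof -
  define u where "u x = Fx_adj f x / (4 * pi)" for x
  define U where "U n x = complex_of_real (gaussw (real (Suc n)) x) * u x" for n x
  have fi: "integrable nu f" by (rule ccont_integrable[OF f])
  note [measurable] = integrable_nu_measurable[OF fi]
  have [measurable]: "u \<in> borel_measurable borel" "U n \<in> borel_measurable borel" for n
    unfolding U_def u_def by measurable
  have ufin: "nrm2 u < \<infinity>"
  proof -
    have "nrm2 (Fx_adj f) < \<infinity>"
      using nrm2_Fx_adj_le[OF fi] ccont_nrm2_finite[OF f]
      by (auto intro: le_less_trans simp: ennreal_mult_less_top)
    hence "nrm2 (\<lambda>x. complex_of_real (1 / (4 * pi)) * Fx_adj f x) < \<infinity>"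
      by (subst nrm2_cmult) (auto simp: ennreal_mult_less_top)
    thus ?thesis by (simp add: u_def[abs_def])
  qed
  have U_le: "cmod (U n x) \<le> cmod (u x)" for n x
    unfolding U_def norm_mult using gaussw_le_1[of "real (Suc n)" x] mult_right_mono[of "gaussw (real (Suc n)) x" 1 "cmod (u x)"]
    by (simp add: abs_of_nonneg)
  have Ufin: "nrm2 (U n) < \<infinity>" for n
    using ufin U_le by (intro le_less_trans[OF nrm2_mono_AE[of "U n" u]]) auto
  have Ui: "integrable nu (U n)" for n
    unfolding U_def
  proof (rule integrable_gaussw_mult)
    fix y
    have "norm (Fx_adj f y) \<le> (\<integral>x. norm (f x) \<partial>nu)"
      using norm_Fx_int_le[of "\<lambda>y. cnj (f y)" y] fi by (simp add: Fx_adj_eq_cnj)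
    thus "norm (u y) \<le> (\<integral>x. norm (f x) \<partial>nu) / (4 * pi)"
      by (simp add: u_def norm_divide norm_mult divide_right_mono)
  qed auto
  have FU: "AE y in nu. Fx_int (U n) y = gconv (real (Suc n)) f y / (4 * pi)" for n
    using AE_nu_nonzero
  proof eventually_elim
    fix y :: real assume y: "y \<noteq> 0"
    have "U n = (\<lambda>x. complex_of_real (1 / (4 * pi)) * (complex_of_real (gaussw (real (Suc n)) x) * Fx_adj f x))"
      by (simp add: U_def u_def fun_eq_iff)
    hence "Fx_int (U n) y = complex_of_real (1 / (4 * pi)) * Fx_int (\<lambda>x. complex_of_real (gaussw (real (Suc n)) x) * Fx_adj f x) y"
      by (simp only:) (rule Fx_int_cmult, measurable)
    thus "Fx_int (U n) y = gconv (real (Suc n)) f y / (4 * pi)"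
      by (simp only: Fx_int_gaussw_Fx_adj[OF _ fi y, of "real (Suc n)"] of_nat_0_less_iff zero_less_Suc) simp
  qed
  have "memL1 winv (U n)" "memL2 winv (U n)" for n
    using Ui Ufin by (auto simp: memL1_winv_iff memL2_winv_iff)
  moreover have "L2conv winv U u"
  proof (subst L2conv_winv_iff)
    show "(\<lambda>n. nrm2 (\<lambda>x. U n x - u x)) \<longlonglongrightarrow> 0"
    proof (rule nrm2_dominated_convergence)
      show "nrm2 (\<lambda>x. 2 * u x) < \<infinity>"
        using ufin by (simp add: nrm2_cmult ennreal_mult_less_top)
      show "AE x in nu. cmod (U n x - u x) \<le> cmod (2 * u x)" for n
      proof (rule AE_I2)
        fix x
        show "cmod (U n x - u x) \<le> cmod (2 * u x)"
          using U_le[of n x] norm_triangle_ineq4[of "U n x" "u x"] by (simp add: norm_mult)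
      qed
      show "AE x in nu. (\<lambda>n. U n x) \<longlonglongrightarrow> u x"
      proof (rule AE_I2)
        fix x
        have "(\<lambda>n. complex_of_real (gaussw (real (Suc n)) x) * u x) \<longlonglongrightarrow> complex_of_real 1 * u x"
          by (intro tendsto_intros gaussw_tendsto_1)
        thus "(\<lambda>n. U n x) \<longlonglongrightarrow> u x" by (simp add: U_def)
      qed
    qed measurable
  qed measurable
  moreover have "L2conv winv (\<lambda>n. Fx_int (U n)) f"
  proof (subst L2conv_winv_iff)
    have "nrm2 (\<lambda>x. Fx_int (U n) x - f x) = nrm2 (\<lambda>x. gconv (real (Suc n)) f x / (4 * pi) - f x)" for n
      using FU[of n] by (intro nrm2_cong_AE) auto
    thus "(\<lambda>n. nrm2 (\<lambda>x. Fx_int (U n) x - f x)) \<longlonglongrightarrow> 0"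
      using gconv_tendsto[OF f] by simp
  qed measurable
  ultimately have "Fx_rel u f"
    using ufin ccont_nrm2_finite[OF f] unfolding Fx_rel_def memL2_winv_iff[of u] memL2_winv_iff[of f]
    by (intro conjI exI[of _ U]) auto
  thus ?thesis by (simp add: u_def[abs_def])
qed

section \<open>Surjectivity\<close>

text \<open>The first factor is a ramp in ln|x|, equal to 1 up to radius M and to 0 beyond M + 1;
  the second projects values radially onto the disc of radius M. Both are continuous operations, so
  truncation preserves continuity off 0 and pointwise limits.\<close>

definition trunc :: "real \<Rightarrow> (real \<Rightarrow> complex) \<Rightarrow> real \<Rightarrow> complex" where
  "trunc M f x = complex_of_real (max 0 (min 1 (M + 1 - \<bar>ln \<bar>x\<bar>\<bar>)) * (M / max M (cmod (f x)))) * f x"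

lemma trunc_measurable [measurable]:
  assumes [measurable]: "f \<in> borel_measurable borel"
  shows "trunc M f \<in> borel_measurable borel"
  unfolding trunc_def by measurable

lemma norm_trunc_le:
  assumes M: "M > 0"
  shows "cmod (trunc M f x) \<le> M * indicator {x. \<bar>ln \<bar>x\<bar>\<bar> \<le> M + 1} x"
    and "cmod (trunc M f x) \<le> cmod (f x)"
proof -
  define a where "a = max 0 (min 1 (M + 1 - \<bar>ln \<bar>x\<bar>\<bar>))"
  have a: "0 \<le> a" "a \<le> 1" "\<not> \<bar>ln \<bar>x\<bar>\<bar> \<le> M + 1 \<Longrightarrow> a = 0"
    by (auto simp: a_def)
  define b where "b = M / max M (cmod (f x))"
  have b: "0 \<le> b" "b \<le> 1" "b * cmod (f x) \<le> M"
    using M by (auto simp: b_def divide_simps max_def)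
  have n: "cmod (trunc M f x) = a * (b * cmod (f x))"
    unfolding trunc_def norm_mult norm_of_real a_def[symmetric] b_def[symmetric] using a b by simp
  have "a * (b * cmod (f x)) \<le> 1 * (b * cmod (f x))"
    using a b by (intro mult_right_mono) auto
  moreover have "b * cmod (f x) \<le> 1 * cmod (f x)"
    using b by (intro mult_right_mono) auto
  ultimately show "cmod (trunc M f x) \<le> M * indicator {x. \<bar>ln \<bar>x\<bar>\<bar> \<le> M + 1} x"
      "cmod (trunc M f x) \<le> cmod (f x)"
    using a b by (auto simp: n indicator_def)
qed

lemma tendsto_trunc:
  assumes M: "M > 0" and "((\<lambda>n. f n x) \<longlongrightarrow> g x) F"
  shows "((\<lambda>n. trunc M (f n) x) \<longlongrightarrow> trunc M g x) F"
  unfolding trunc_def using M by (intro tendsto_intros assms) auto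

lemma trunc_tendsto: "(\<lambda>n. trunc (real (Suc n)) f x) \<longlonglongrightarrow> f x"
proof (rule tendsto_eventually)
  obtain N where N: "real N \<ge> max \<bar>ln \<bar>x\<bar>\<bar> (cmod (f x))" using real_arch_simple by blast
  show "eventually (\<lambda>n. trunc (real (Suc n)) f x = f x) sequentially"
    using eventually_ge_at_top[of N]
  proof eventually_elim
    case (elim n)
    hence "real n \<ge> \<bar>ln \<bar>x\<bar>\<bar>" "real n \<ge> cmod (f x)" using N by auto
    hence "max 0 (min 1 (real (Suc n) + 1 - \<bar>ln \<bar>x\<bar>\<bar>)) = 1" "max (real (Suc n)) (cmod (f x)) = real (Suc n)"
      by auto
    thus ?case by (simp add: trunc_def)
  qed
qed

lemma ccont_trunc:
  assumes M: "M > 0" and g: "continuous_on UNIV g"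
  shows "ccont M (M + 1) (trunc M g)"
  unfolding ccont_def
proof (intro conjI allI impI)
  have [measurable]: "g \<in> borel_measurable borel"
    by (rule borel_measurable_continuous_onI[OF g])
  show "trunc M g \<in> borel_measurable borel" by measurable
  fix x
  show "cmod (trunc M g x) \<le> M"
    by (rule order_trans[OF norm_trunc_le(1)[OF M]]) (use M in \<open>simp add: indicator_def\<close>)
  show "trunc M g x \<noteq> 0 \<Longrightarrow> \<bar>ln \<bar>x\<bar>\<bar> \<le> M + 1"
    using norm_trunc_le(1)[OF M, of g x] by (rule_tac ccontr) simp
  assume x: "x \<noteq> 0"
  have "isCont g x" using g by (simp add: continuous_on_eq_continuous_at)
  thus "isCont (trunc M g) x"
    unfolding trunc_def[abs_def] using M x by (intro continuous_intros) auto
qed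

lemma AE_lborel_imp_AE_nu: "AE x in lborel. P x \<Longrightarrow> AE x in nu. P x"
  unfolding nu_def by (subst AE_density) (auto elim!: eventually_mono)

text \<open>First truncate \<open>f\<close> at a level M close to it in L2. A Lebesgue measurable
  function is an almost everywhere limit of continuous functions; truncating these at the same M
  puts them in the class and provides a common square integrable majorant.\<close>

lemma ccont_dense:
  assumes [measurable]: "f \<in> borel_measurable borel" and fin: "nrm2 f < \<infinity>" and e: "e > (0::real)"
  shows "\<exists>B R \<psi>. ccont B R \<psi> \<and> nrm2 (\<lambda>x. \<psi> x - f x) \<le> ennreal e"
proof -
  have "(\<lambda>n. nrm2 (\<lambda>x. trunc (real (Suc n)) f x - f x)) \<longlonglongrightarrow> 0"
  proof (rule nrm2_dominated_convergence)
    show "nrm2 (\<lambda>x. 2 * f x) < \<infinity>"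
      using fin by (simp add: nrm2_cmult ennreal_mult_less_top)
    show "AE x in nu. cmod (trunc (real (Suc n)) f x - f x) \<le> cmod (2 * f x)" for n
    proof (rule AE_I2)
      fix x
      show "cmod (trunc (real (Suc n)) f x - f x) \<le> cmod (2 * f x)"
        using norm_trunc_le(2)[of "real (Suc n)" f x] norm_triangle_ineq4[of "trunc (real (Suc n)) f x" "f x"]
        by (simp add: norm_mult)
    qed
    show "AE x in nu. (\<lambda>n. trunc (real (Suc n)) f x) \<longlonglongrightarrow> f x"
      by (intro AE_I2 trunc_tendsto)
  qed measurable
  hence "eventually (\<lambda>n. nrm2 (\<lambda>x. trunc (real (Suc n)) f x - f x) < ennreal (e / 4)) sequentially"
    using e by (intro tendsto_0_ennrealD) auto
  then obtain m where m: "nrm2 (\<lambda>x. trunc (real (Suc m)) f x - f x) < ennreal (e / 4)"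
    by (auto simp: eventually_sequentially)
  define M where "M = real (Suc m)"
  have M: "M > 0" by (simp add: M_def)
  have "f \<in> borel_measurable lebesgue"
    by (rule measurable_completion) (use assms(1) in simp)
  hence "f measurable_on UNIV"
    by (intro lebesgue_measurable_imp_measurable_on) auto
  then obtain N g where N: "negligible N" and g: "\<And>n. continuous_on UNIV (g n)"
    and lim: "\<And>x. x \<notin> N \<Longrightarrow> (\<lambda>n. g n x) \<longlonglongrightarrow> f x"
    by (auto simp: measurable_on_def)
  have [measurable]: "g n \<in> borel_measurable borel" for n
    by (rule borel_measurable_continuous_onI[OF g])
  have "AE x in lebesgue. x \<notin> N"
    using N by (intro AE_not_in) (simp add: negligible_iff_null_sets)
  hence "AE x in lborel. x \<notin> N"
    by (simp add: AE_completion_iff)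
  hence aeN: "AE x in nu. x \<notin> N"
    by (rule AE_lborel_imp_AE_nu)
  have "(\<lambda>n. nrm2 (\<lambda>x. trunc M (g n) x - trunc M f x)) \<longlonglongrightarrow> 0"
  proof (rule nrm2_dominated_convergence)
    let ?I = "indicator {x. \<bar>ln \<bar>x\<bar>\<bar> \<le> M + 1} :: real \<Rightarrow> real"
    show "(\<lambda>x. complex_of_real (2 * M * ?I x)) \<in> borel_measurable borel"
      by measurable
    show "nrm2 (\<lambda>x. complex_of_real (2 * M * ?I x)) < \<infinity>"
      using M by (intro nrm2_finite_if_bounded_support[where B = "2 * M" and R = "M + 1"]) (simp add: norm_mult indicator_def)
    show "AE x in nu. cmod (trunc M (g n) x - trunc M f x) \<le> cmod (complex_of_real (2 * M * ?I x))" for n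
    proof (rule AE_I2)
      fix x
      have "cmod (trunc M (g n) x - trunc M f x) \<le> 2 * M * ?I x"
        using norm_trunc_le(1)[OF M, of "g n" x] norm_trunc_le(1)[OF M, of f x]
          norm_triangle_ineq4[of "trunc M (g n) x" "trunc M f x"] by linarith
      thus "cmod (trunc M (g n) x - trunc M f x) \<le> cmod (complex_of_real (2 * M * ?I x))"
        by (simp only: norm_of_real)
    qed
    show "AE x in nu. (\<lambda>n. trunc M (g n) x) \<longlonglongrightarrow> trunc M f x"
      using aeN by eventually_elim (intro tendsto_trunc[OF M] lim)
  qed measurable
  hence "eventually (\<lambda>n. nrm2 (\<lambda>x. trunc M (g n) x - trunc M f x) < ennreal (e / 4)) sequentially"
    using e by (intro tendsto_0_ennrealD) auto
  then obtain n where n: "nrm2 (\<lambda>x. trunc M (g n) x - trunc M f x) < ennreal (e / 4)"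
    by (auto simp: eventually_sequentially)
  have "nrm2 (\<lambda>x. trunc M (g n) x - f x) \<le> ennreal (2 * (e / 4) + 2 * (e / 4))"
    using n m e by (intro nrm2_triangle_less[of _ "trunc M f" f "e / 4" "e / 4"]) (auto simp: M_def)
  thus ?thesis
    using ccont_trunc[OF M g, of n] by auto
qed

text \<open>Riesz-Fischer. As \<open>nu\<close> is infinite, L2 is not contained in L1; the positive
  integrable weight \<open>w\<close>, with w^2 at most w, makes the sequence Cauchy in L1 by
  Cauchy-Schwarz. An almost everywhere Cauchy subsequence then supplies the limit, and Fatou the
  norm convergence of the whole sequence.\<close>

lemma nrm2_complete:
  fixes U :: "nat \<Rightarrow> real \<Rightarrow> complex"
  assumes [measurable]: "\<And>n. U n \<in> borel_measurable borel" and fin: "\<And>n. nrm2 (U n) < \<infinity>"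
    and cauchy: "\<And>e::real. e > 0 \<Longrightarrow> \<exists>N. \<forall>i\<ge>N. \<forall>j\<ge>N. nrm2 (\<lambda>x. U i x - U j x) \<le> ennreal e"
  shows "\<exists>u. u \<in> borel_measurable borel \<and> nrm2 u < \<infinity> \<and> (\<lambda>n. nrm2 (\<lambda>x. U n x - u x)) \<longlonglongrightarrow> 0"
proof -
  define w where "w = gaussw 1"
  have w: "w x > 0" "w x \<le> 1" for x
    by (simp_all add: w_def gaussw_def)
  have [measurable]: "w \<in> borel_measurable borel" by (simp add: w_def)
  define C where "C = (\<integral>x. w x \<partial>nu)"
  have C: "(\<integral>\<^sup>+x. ennreal (w x) \<partial>nu) = ennreal C" "C \<ge> 0"
    unfolding C_def using integrable_gaussw[of 1] less_imp_le[OF w(1)]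
    by (auto simp: w_def[symmetric] intro!: nn_integral_eq_integral Bochner_Integration.integral_nonneg)
  have weighted: "(\<integral>\<^sup>+x. ennreal (norm (complex_of_real (w x) * v x)) \<partial>nu)\<^sup>2 \<le> ennreal C * nrm2 v"
    if [measurable]: "v \<in> borel_measurable borel" for v
  proof -
    have "(\<integral>\<^sup>+x. ennreal (norm (complex_of_real (w x) * v x)) \<partial>nu)\<^sup>2
        = (\<integral>\<^sup>+x. ennreal (w x) * ennreal (cmod (v x)) \<partial>nu)\<^sup>2"
      using less_imp_le[OF w(1)] by (simp add: norm_mult ennreal_mult')
    also have "\<dots> \<le> (\<integral>\<^sup>+x. (ennreal (w x))\<^sup>2 \<partial>nu) * (\<integral>\<^sup>+x. (ennreal (cmod (v x)))\<^sup>2 \<partial>nu)"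
      by (rule Cauchy_Schwarz_nn_integral) measurable
    also have "(\<integral>\<^sup>+x. (ennreal (cmod (v x)))\<^sup>2 \<partial>nu) = nrm2 v"
      by (simp add: nrm2_def ennreal_power)
    also have "(\<integral>\<^sup>+x. (ennreal (w x))\<^sup>2 \<partial>nu) \<le> (\<integral>\<^sup>+x. ennreal (w x) \<partial>nu)"
    proof (rule nn_integral_mono)
      fix x
      have "(w x)\<^sup>2 \<le> w x"
        using w[of x] mult_left_le[of "w x" "w x"] by (simp add: power2_eq_square)
      thus "(ennreal (w x))\<^sup>2 \<le> ennreal (w x)"
        using w[of x] by (simp add: ennreal_power ennreal_leI)
    qed
    finally show ?thesis by (simp add: C(1) mult_right_mono)
  qed
  obtain r where r: "strict_mono r" "AE x in nu. Cauchy (\<lambda>i. complex_of_real (w x) * U (r i) x)"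
  proof (rule cauchy_L1_AE_cauchy_subseq[of nu "\<lambda>n x. complex_of_real (w x) * U n x"])
    show wi: "integrable nu (\<lambda>x. complex_of_real (w x) * U n x)" for n
    proof (rule integrableI_bounded)
      have "(\<integral>\<^sup>+x. ennreal (norm (complex_of_real (w x) * U n x)) \<partial>nu)\<^sup>2 < \<infinity>"
        using weighted[of "U n"] fin[of n] by (auto intro: le_less_trans simp: ennreal_mult_less_top)
      thus "(\<integral>\<^sup>+x. ennreal (norm (complex_of_real (w x) * U n x)) \<partial>nu) < \<infinity>"
        by (simp add: power_less_top_ennreal)
    qed measurable
    fix e :: real assume e: "e > 0"
    \<comment> \<open>Chosen so that C d is at most (e / 2)^2 even if C = 0; halving
      \<open>e\<close> yields the strict inequality required.\<close>
    define d where "d = (e / 2)\<^sup>2 / (C + 1)"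
    have d: "d > 0" "C * d \<le> (e / 2)\<^sup>2"
      using e C(2) by (auto simp: d_def field_simps)
    obtain N where N: "\<And>i j. i \<ge> N \<Longrightarrow> j \<ge> N \<Longrightarrow> nrm2 (\<lambda>x. U i x - U j x) \<le> ennreal d"
      using cauchy[OF d(1)] by blast
    show "\<exists>N. \<forall>i\<ge>N. \<forall>j\<ge>N. (\<integral>x. norm (complex_of_real (w x) * U i x - complex_of_real (w x) * U j x) \<partial>nu) < e"
    proof (intro exI allI impI)
      fix i j assume ij: "i \<ge> N" "j \<ge> N"
      define X where "X = (\<integral>x. norm (complex_of_real (w x) * U i x - complex_of_real (w x) * U j x) \<partial>nu)"
      have X0: "X \<ge> 0" unfolding X_def by (intro Bochner_Integration.integral_nonneg) simp
      have "ennreal X = (\<integral>\<^sup>+x. ennreal (norm (complex_of_real (w x) * U i x - complex_of_real (w x) * U j x)) \<partial>nu)"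
        unfolding X_def using wi by (intro nn_integral_eq_integral[symmetric]) auto
      also have "\<dots> = (\<integral>\<^sup>+x. ennreal (norm (complex_of_real (w x) * (U i x - U j x))) \<partial>nu)"
        by (simp add: right_diff_distrib)
      finally have "(ennreal X)\<^sup>2 \<le> ennreal C * nrm2 (\<lambda>x. U i x - U j x)"
        using weighted[of "\<lambda>x. U i x - U j x"] by simp
      also have "\<dots> \<le> ennreal C * ennreal d"
        by (intro mult_left_mono N ij) simp
      also have "\<dots> \<le> ennreal ((e / 2)\<^sup>2)"
        using C(2) d by (simp add: ennreal_leI flip: ennreal_mult)
      finally have "X\<^sup>2 \<le> (e / 2)\<^sup>2"
        using X0 by (simp add: ennreal_power)
      hence "X \<le> e / 2" using e by (simp add: power2_le_iff_abs_le)
      thus "(\<integral>x. norm (complex_of_real (w x) * U i x - complex_of_real (w x) * U j x) \<partial>nu) < e"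
        using e unfolding X_def by linarith
    qed
  qed auto
  define u where "u x = lim (\<lambda>i. U (r i) x)" for x
  have [measurable]: "u \<in> borel_measurable borel"
    unfolding u_def[abs_def] by measurable
  have lim: "AE x in nu. (\<lambda>i. U (r i) x) \<longlonglongrightarrow> u x"
    using r(2)
  proof eventually_elim
    case (elim x)
    then obtain l where "(\<lambda>i. complex_of_real (w x) * U (r i) x) \<longlonglongrightarrow> l"
      by (auto simp: Cauchy_convergent_iff convergent_def)
    hence "(\<lambda>i. complex_of_real (w x) * U (r i) x / complex_of_real (w x)) \<longlonglongrightarrow> l / complex_of_real (w x)"
      using w(1)[of x] by (intro tendsto_divide tendsto_const) auto
    hence "(\<lambda>i. U (r i) x) \<longlonglongrightarrow> l / complex_of_real (w x)"
      using w(1)[of x] by simp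
    thus ?case unfolding u_def by (metis limI)
  qed
  have close: "\<exists>N. \<forall>n\<ge>N. nrm2 (\<lambda>x. U n x - u x) \<le> ennreal e" if e: "e > 0" for e :: real
  proof -
    obtain N where N: "\<And>i j. i \<ge> N \<Longrightarrow> j \<ge> N \<Longrightarrow> nrm2 (\<lambda>x. U i x - U j x) \<le> ennreal e"
      using cauchy[OF e] by blast
    \<comment> \<open>The shift to \<open>r (i + N)\<close> puts every index of the subsequence at
      or beyond N, where the Cauchy bound holds, so Fatou can use it for all
      \<open>i\<close>.\<close>
    have "nrm2 (\<lambda>x. U n x - u x) \<le> ennreal e" if n: "n \<ge> N" for n
      unfolding nrm2_def
    proof (rule nn_integral_le_of_tendsto)
      show "(\<integral>\<^sup>+x. ennreal ((cmod (U n x - U (r (i + N)) x))\<^sup>2) \<partial>nu) \<le> ennreal e" for i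
        using N[OF n, of "r (i + N)"] seq_suble[OF r(1), of "i + N"] by (simp add: nrm2_def)
      show "AE x in nu. (\<lambda>i. ennreal ((cmod (U n x - U (r (i + N)) x))\<^sup>2)) \<longlonglongrightarrow> ennreal ((cmod (U n x - u x))\<^sup>2)"
        using lim by eventually_elim (intro tendsto_intros tendsto_ennrealI LIMSEQ_ignore_initial_segment)
    qed measurable
    thus ?thesis by blast
  qed
  obtain N where "nrm2 (\<lambda>x. U N x - u x) \<le> ennreal 1"
    using close[of 1] by auto
  hence "nrm2 (\<lambda>x. u x - U N x) < \<infinity>"
    using nrm2_commute[of u "U N"] by (auto intro: le_less_trans)
  hence "nrm2 u < \<infinity>"
    using fin[of N] by (intro nrm2_finite_if_close[of u "U N"]) auto
  moreover have "(\<lambda>n. nrm2 (\<lambda>x. U n x - u x)) \<longlonglongrightarrow> 0"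
    using close by (intro tendsto_0_ennrealI) (auto simp: eventually_sequentially)
  ultimately show ?thesis by (intro exI[of _ u]) auto
qed

text \<open>Approximate \<open>v\<close> by functions of the dense class, whose preimages are
  explicit. Dividing the adjoint by \<open>4 * pi\<close> multiplies \<open>nrm2\<close> by at most
  1 / (4 pi), below 1, so the preimages are Cauchy; completeness and closedness finish.\<close>

lemma Fx_rel_exists:
  assumes [measurable]: "v \<in> borel_measurable borel" and fin: "nrm2 v < \<infinity>"
  shows "\<exists>u. Fx_rel u v"
proof -
  have "\<forall>n. \<exists>\<psi>. (\<exists>B R. ccont B R \<psi>) \<and> nrm2 (\<lambda>x. \<psi> x - v x) \<le> ennreal (inverse (real (Suc n)))"
    using ccont_dense[OF assms] by (metis inverse_positive_iff_positive of_nat_0_less_iff zero_less_Suc)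
  then obtain \<psi> where \<psi>: "\<And>n. \<exists>B R. ccont B R (\<psi> n)" "\<And>n. nrm2 (\<lambda>x. \<psi> n x - v x) \<le> ennreal (inverse (real (Suc n)))"
    by metis
  have \<psi>i: "integrable nu (\<psi> n)" for n
    using \<psi>(1)[of n] ccont_integrable by blast
  have [measurable]: "\<psi> n \<in> borel_measurable borel" for n
    by (rule integrable_nu_measurable[OF \<psi>i])
  define U where "U n x = Fx_adj (\<psi> n) x / (4 * pi)" for n x
  have rel: "Fx_rel (U n) (\<psi> n)" for n
    using \<psi>(1)[of n] Fx_rel_Fx_adj unfolding U_def[abs_def] by blast
  have [measurable]: "U n \<in> borel_measurable borel" for n
    using rel[of n] by (simp add: Fx_rel_iff)
  have diff: "nrm2 (\<lambda>x. U i x - U j x) \<le> nrm2 (\<lambda>x. \<psi> i x - \<psi> j x)" for i j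
  proof -
    have "nrm2 (\<lambda>x. U i x - U j x) = nrm2 (\<lambda>x. complex_of_real (1 / (4 * pi)) * Fx_adj (\<lambda>x. \<psi> i x - \<psi> j x) x)"
      by (rule nrm2_cong_AE) (simp add: U_def Fx_adj_diff[OF \<psi>i \<psi>i] diff_divide_distrib)
    also have "\<dots> = ennreal ((1 / (4 * pi))\<^sup>2) * nrm2 (Fx_adj (\<lambda>x. \<psi> i x - \<psi> j x))"
      by (subst nrm2_cmult) (auto simp: norm_divide norm_mult)
    also have "\<dots> \<le> ennreal ((1 / (4 * pi))\<^sup>2) * (ennreal (4 * pi) * nrm2 (\<lambda>x. \<psi> i x - \<psi> j x))"
      by (intro mult_left_mono nrm2_Fx_adj_le Bochner_Integration.integrable_diff \<psi>i) auto
    also have "\<dots> = ennreal ((1 / (4 * pi))\<^sup>2 * (4 * pi)) * nrm2 (\<lambda>x. \<psi> i x - \<psi> j x)"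
      by (subst ennreal_mult) (auto simp: mult.assoc)
    also have "\<dots> \<le> ennreal 1 * nrm2 (\<lambda>x. \<psi> i x - \<psi> j x)"
    proof (intro mult_right_mono ennreal_leI)
      have "(1 / (4 * pi))\<^sup>2 * (4 * pi) = 1 / (4 * pi)" by (simp add: power2_eq_square)
      also have "\<dots> \<le> 1" using pi_gt3 by simp
      finally show "(1 / (4 * pi))\<^sup>2 * (4 * pi) \<le> 1" .
    qed simp
    finally show ?thesis by simp
  qed
  have "\<exists>u. u \<in> borel_measurable borel \<and> nrm2 u < \<infinity> \<and> (\<lambda>n. nrm2 (\<lambda>x. U n x - u x)) \<longlonglongrightarrow> 0"
  proof (rule nrm2_complete)
    show "nrm2 (U n) < \<infinity>" for n using rel[of n] by (simp add: Fx_rel_iff)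
    fix e :: real assume e: "e > 0"
    then obtain N where N: "inverse (real (Suc N)) < e / 4"
      using reals_Archimedean[of "e / 4"] by auto
    show "\<exists>N. \<forall>i\<ge>N. \<forall>j\<ge>N. nrm2 (\<lambda>x. U i x - U j x) \<le> ennreal e"
    proof (intro exI allI impI)
      have near: "nrm2 (\<lambda>x. \<psi> n x - v x) \<le> ennreal (e / 4)" if "n \<ge> N" for n
      proof -
        have "inverse (real (Suc n)) \<le> inverse (real (Suc N))"
          using that by (intro le_imp_inverse_le) auto
        hence "ennreal (inverse (real (Suc n))) \<le> ennreal (e / 4)"
          using N by (intro ennreal_leI) linarith
        thus ?thesis using \<psi>(2)[of n] by (rule order_trans[rotated])
      qed
      fix i j assume ij: "i \<ge> N" "j \<ge> N"
      have "nrm2 (\<lambda>x. \<psi> i x - \<psi> j x) \<le> ennreal (2 * (e / 4) + 2 * (e / 4))"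
      proof (rule nrm2_triangle_less[of _ v])
        show "nrm2 (\<lambda>x. \<psi> i x - v x) \<le> ennreal (e / 4)" by (rule near[OF ij(1)])
        show "nrm2 (\<lambda>x. v x - \<psi> j x) \<le> ennreal (e / 4)"
          using near[OF ij(2)] nrm2_commute[of v "\<psi> j"] by simp
      qed (use e in auto)
      thus "nrm2 (\<lambda>x. U i x - U j x) \<le> ennreal e"
        using diff[of i j] by simp
    qed
  qed measurable
  then obtain u where um: "u \<in> borel_measurable borel" and u: "nrm2 u < \<infinity>" "(\<lambda>n. nrm2 (\<lambda>x. U n x - u x)) \<longlonglongrightarrow> 0"
    by blast
  have lim0: "(\<lambda>n. ennreal (inverse (real (Suc n)))) \<longlonglongrightarrow> 0"
    using tendsto_ennrealI[OF LIMSEQ_inverse_real_of_nat] by simp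
  have \<psi>_lim: "(\<lambda>n. nrm2 (\<lambda>x. \<psi> n x - v x)) \<longlonglongrightarrow> 0"
    by (rule tendsto_sandwich[OF _ _ tendsto_const lim0]; use \<psi>(2) in simp)
  have "Fx_rel u v"
    by (rule Fx_rel_closed[OF rel um assms(1) u(1) fin u(2) \<psi>_lim])
  thus ?thesis by blast
qed

section \<open>The symbol of the operator\<close>

text \<open>\<open>g\<close> and \<open>h\<close> are only Lebesgue measurable, so the kernel lives
  on the completed measure, where Tonelli needs sigma-finiteness.\<close>

lemma sigma_finite_completion:
  assumes "sigma_finite_measure M"
  shows "sigma_finite_measure (completion M)"
proof -
  obtain A where "countable A" "A \<subseteq> sets M" "\<Union>A = space M" "\<forall>a\<in>A. emeasure M a \<noteq> \<infinity>"
    using assms unfolding sigma_finite_measure_def by blast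
  thus ?thesis
    by (intro sigma_finite_measure.intro exI[of _ A]) auto
qed

lemma continuous_on_integral_cis:
  assumes k: "integrable M k" and r: "r \<in> borel_measurable M"
  shows "continuous_on UNIV (\<lambda>x. \<integral>s. k s * cis (x * r s) \<partial>M)"
  unfolding continuous_on_sequentially comp_def
proof (intro ballI allI impI)
  fix X :: "nat \<Rightarrow> real" and a assume "(\<forall>n. X n \<in> UNIV) \<and> X \<longlonglongrightarrow> a"
  hence X: "X \<longlonglongrightarrow> a" by simp
  note [measurable] = r borel_measurable_integrable[OF k]
  show "(\<lambda>n. \<integral>s. k s * cis (X n * r s) \<partial>M) \<longlonglongrightarrow> (\<integral>s. k s * cis (a * r s) \<partial>M)"
  proof (rule integral_dominated_convergence)
    show "integrable M (\<lambda>s. norm (k s))" using k by simp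
    show "AE s in M. norm (k s * cis (X n * r s)) \<le> norm (k s)" for n
      by (simp add: norm_mult)
    show "AE s in M. (\<lambda>n. k s * cis (X n * r s)) \<longlonglongrightarrow> k s * cis (a * r s)"
      using X by (intro AE_I2 tendsto_intros)
  qed measurable
qed

theorem mainTheorem13:
  fixes c :: real and g h :: "real^'n \<Rightarrow> real"
  assumes "g \<in> borel_measurable lebesgue" and "h \<in> borel_measurable lebesgue"
    and "(\<integral>\<^sup>+ s. ennreal (indicator {s. h s \<noteq> 0} s * (\<bar>g s\<bar> * \<bar>h s\<bar> powr (- (c + 1) / 2))) \<partial>lebesgue) < \<infinity>"
  shows "bounded (range (mu c g h)) \<and> continuous_on {y. y \<noteq> 0} (mu c g h) \<and>
    (\<forall>\<phi>. memL2 winv \<phi> \<longrightarrow> (AE y in lborel. Gtilde c g h \<phi> y = mu c g h y * \<phi> y))"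
proof -
  \<comment> \<open>\<open>g\<close> together with the power of |h| that is left over from
    \<open>Mop\<close> and its inverse.\<close>
  let ?k = "\<lambda>s. indicator {s. h s \<noteq> 0} s * complex_of_real (g s * \<bar>h s\<bar> powr (- (c + 1) / 2))"
  note [measurable] = assms(1,2)
  interpret L: sigma_finite_measure "lebesgue :: (real^'n) measure"
    by (rule sigma_finite_completion) (rule lborel.sigma_finite_measure_axioms)
  have k: "integrable lebesgue ?k"
  proof (rule integrableI_bounded)
    have "norm (?k s) = indicator {s. h s \<noteq> 0} s * (\<bar>g s\<bar> * \<bar>h s\<bar> powr (- (c + 1) / 2))" for s
      by (simp add: norm_mult indicator_def abs_mult)
    thus "(\<integral>\<^sup>+s. ennreal (norm (?k s)) \<partial>lebesgue) < \<infinity>"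
      using assms(3) by simp
  qed measurable
  interpret K: mconv lebesgue ?k h
    by unfold_locales (use k in \<open>auto simp: indicator_def\<close>)
  \<comment> \<open>Conjugation turns the phase into \<open>cis (ln|y| * ln|h s|)\<close>. For
    positive \<open>y\<close> the sign factor of \<open>chi\<close> is trivial; for negative
    \<open>y\<close> it is the sign of \<open>h s\<close>, which separates \<open>m_plus\<close>
    from \<open>m_minus\<close>.\<close>
  have mu_symbol: "mu c g h y = K.symbol y" if "y \<noteq> 0" for y
  proof (cases "y > 0")
    case True
    have "m_plus c g h (ln \<bar>y\<bar>) = K.symbol y"
      unfolding m_plus_def K.symbol_def using True
      by (intro Bochner_Integration.integral_cong refl) (simp add: chi_def delta_def cis_cnj mult.commute)
    thus ?thesis using True by (simp add: mu_def)
  next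
    case False
    have "m_minus c g h (ln \<bar>y\<bar>) = K.symbol y"
      unfolding m_minus_def K.symbol_def
    proof (intro Bochner_Integration.integral_cong refl)
      fix s
      show "?k s * cis (ln \<bar>y\<bar> * ln \<bar>h s\<bar>) * complex_of_real (sgn (h s)) = ?k s * cnj (chi (h s) y)"
      proof (cases "h s = 0")
        case h: False
        have cis_minus_pi: "cis (- pi) = - 1" by (simp add: complex_eq_iff)
        have "delta y = 1" using False that by (simp add: delta_def)
        hence "cnj (chi (h s) y) = cis (ln \<bar>y\<bar> * ln \<bar>h s\<bar>) * complex_of_real (sgn (h s))"
          using h cis_minus_pi by (auto simp: chi_def delta_def cis_cnj mult.commute)
        thus ?thesis by (simp add: mult.assoc)
      qed simp
    qed
    thus ?thesis using False by (simp add: mu_def)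
  qed
  \<comment> \<open>At 0 the \<open>m_minus\<close> branch applies with \<open>ln 0 = 0\<close>, the
    same logarithm as at -1; so the bound for the symbol off 0 covers the whole range.\<close>
  have mu_0: "mu c g h 0 = mu c g h (- 1)"
    by (simp add: mu_def)
  have "bounded (range (mu c g h))"
  proof (rule boundedI)
    fix z assume "z \<in> range (mu c g h)"
    then obtain y where "z = mu c g h y" by blast
    then obtain y where y: "y \<noteq> 0" "z = mu c g h y"
      using mu_0 by (cases "y = 0") (metis neg_equal_0_iff_equal one_neq_zero, blast)
    show "norm z \<le> enn2real K.mass"
      unfolding y(2) mu_symbol[OF y(1)] by (rule K.norm_symbol_le)
  qed
  moreover have "continuous_on {y. y \<noteq> 0} (mu c g h)"
  proof -
    have mp: "continuous_on UNIV (m_plus c g h)"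
      unfolding m_plus_def[abs_def] by (rule continuous_on_integral_cis[OF k]) measurable
    have k': "integrable lebesgue (\<lambda>s. ?k s * complex_of_real (sgn (h s)))"
      by (rule Bochner_Integration.integrable_bound[OF k]) (auto simp: norm_mult sgn_if)
    have "continuous_on UNIV (\<lambda>x. \<integral>s. ?k s * complex_of_real (sgn (h s)) * cis (x * ln \<bar>h s\<bar>) \<partial>lebesgue)"
      by (rule continuous_on_integral_cis[OF k']) measurable
    hence mm: "continuous_on UNIV (m_minus c g h)"
      unfolding m_minus_def[abs_def] by (simp add: mult_ac)
    have "continuous_on {0<..} (mu c g h)"
    proof (rule continuous_on_eq)
      show "continuous_on {0<..} (\<lambda>y. m_plus c g h (ln \<bar>y\<bar>))"
        by (intro continuous_on_compose2[OF mp] continuous_intros) auto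
    qed (simp add: mu_def)
    moreover have "continuous_on {..<0} (mu c g h)"
    proof (rule continuous_on_eq)
      show "continuous_on {..<0} (\<lambda>y. m_minus c g h (ln \<bar>y\<bar>))"
        by (intro continuous_on_compose2[OF mm] continuous_intros) auto
    qed (simp add: mu_def)
    ultimately have "continuous_on ({0<..} \<union> {..<0}) (mu c g h)"
      by (intro continuous_on_open_Un) auto
    moreover have "{y::real. y \<noteq> 0} = {0<..} \<union> {..<0}" by auto
    ultimately show ?thesis by simp
  qed
  moreover have "AE y in lborel. Gtilde c g h \<phi> y = mu c g h y * \<phi> y" if \<phi>: "memL2 winv \<phi>" for \<phi>
  proof -
    have "\<exists>u. Fx_rel u \<phi>"
      using \<phi> by (intro Fx_rel_exists) (auto simp: memL2_winv_iff)
    hence u: "Fx_rel (Fx_inv \<phi>) \<phi>"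
      unfolding Fx_inv_def by (rule someI_ex)
    define u where "u = Fx_inv \<phi>"
    have [measurable]: "u \<in> borel_measurable borel"
      using u by (simp add: u_def Fx_rel_iff)
    define v where "v = Mop c (Gop g h (Mop_inv c u))"
    \<comment> \<open>At 0 the factor \<open>0 powr ...\<close> of \<open>Mop\<close> is 0, whereas
      \<open>K.conv u 0\<close> may not vanish; the two functions are identified only up to this
      null point.\<close>
    have v_eq: "v x = (if x = 0 then 0 else K.conv u x)" for x
    proof (cases "x = 0")
      case True
      thus ?thesis by (simp add: v_def Mop_def)
    next
      case False
      have "v x = (\<integral>s. complex_of_real (\<bar>x\<bar> powr ((c + 1) / 2)) *
          (indicator {s. h s \<noteq> 0} s * complex_of_real (g s) * Mop_inv c u (h s * x)) \<partial>lebesgue)"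
        unfolding v_def Mop_def Gop_def by (rule integral_mult_right_zero[symmetric])
      also have "\<dots> = K.conv u x"
        unfolding K.conv_def
      proof (intro Bochner_Integration.integral_cong refl)
        fix s
        \<comment> \<open>The powers of |x| cancel; for \<open>h s = 0\<close> both sides are
          0.\<close>
        have "\<bar>x\<bar> powr ((c + 1) / 2) * \<bar>h s * x\<bar> powr (- (c + 1) / 2) = \<bar>h s\<bar> powr (- (c + 1) / 2)"
          using False by (simp add: abs_mult powr_mult powr_add[symmetric] mult.commute mult.left_commute flip: add_divide_distrib)
        hence pw: "complex_of_real (\<bar>x\<bar> powr ((c + 1) / 2)) * complex_of_real (\<bar>h s * x\<bar> powr (- (c + 1) / 2))
            = complex_of_real (\<bar>h s\<bar> powr (- (c + 1) / 2))"
          by (simp only: of_real_mult[symmetric])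
        show "complex_of_real (\<bar>x\<bar> powr ((c + 1) / 2)) *
            (indicator {s. h s \<noteq> 0} s * complex_of_real (g s) * Mop_inv c u (h s * x)) = ?k s * u (h s * x)"
          unfolding Mop_inv_def of_real_mult[of "g s"] pw[symmetric] by (simp only: mult_ac)
      qed
      finally show ?thesis using False by simp
    qed
    have "Fx_rel (K.conv u) (\<lambda>y. K.symbol y * \<phi> y)"
      using K.Fx_rel_conv[OF u] by (simp add: u_def)
    hence rel: "Fx_rel v (\<lambda>y. K.symbol y * \<phi> y)"
    proof (rule Fx_rel_cong)
      show "v \<in> borel_measurable borel"
        unfolding v_eq[abs_def] by measurable
      show "AE x in nu. v x = K.conv u x"
        using AE_nu_nonzero by eventually_elim (simp add: v_eq)
    qed
    \<comment> \<open>Since \<open>v\<close> has some transform, the one selected by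
      \<open>Fx\<close> is a transform too, and single-valuedness identifies it with the product
      almost everywhere.\<close>
    hence "Fx_rel v (Fx v)"
      unfolding Fx_def by (rule someI[of "Fx_rel v"])
    hence "AE y in nu. Fx v y = K.symbol y * \<phi> y"
      using rel by (rule Fx_rel_unique)
    with AE_nu_nonzero have "AE y in nu. Gtilde c g h \<phi> y = mu c g h y * \<phi> y"
      by eventually_elim (simp add: Gtilde_def v_def u_def mu_symbol)
    thus ?thesis by (rule AE_lborel_if_AE_nu)
  qed
  ultimately show ?thesis by blast
qed

end
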